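(* The right Kan extension $Ran_{\iota}(\mathbf{\Sigma}''):\mathbf{SCvx}\to\mathbf{Meas}$ of the functor $\mathbf{\Sigma}'':\mathbf{\Omega}\to\mathbf{Meas}$ along the inclusion functor $\iota:\mathbf{\Omega}\hookrightarrow\mathbf{SCvx}$ has the universal arrow $\varepsilon:Ran_{\iota}(\mathbf{\Sigma}'')\circ\iota\Rightarrow\mathbf{\Sigma}''$ specified at component $\mathsf{N}$ by $\varepsilon_{\mathsf{N}}=1_{\mathbb{N}}$ and at component $\Delta_{\mathbb{N}}$ by $\varepsilon_{\Delta_{\mathbb{N}}}=1_{\mathcal{G}\mathbb{N}}$. (Hence $Ran_{\iota}(\mathbf{\Sigma}'')$ really is an extension of $\mathbf{\Sigma}''$.)
   Context: $\mathbb{N}=\{0,1,2,\dots\}$; as a measurable space it carries the powerset $\sigma$-algebra. $\mathcal{G}\mathbb{N}$ is the set of sequences $\mathbf{p}:\mathbb{N}\to[0,1]$ with $\sum_i p_i=1$, identified with the probability measures $\sum_i p_i\delta_i$ on $\mathbb{N}$; as a measurable space it carries the smallest $\sigma$-algebra making all evaluations $ev_W:\mathbf{p}\mapsto\sum_{i\in W}p_i$, $W\subseteq\mathbb{N}$, measurable. A super convex space is a set $A$ with a function $\mathcal{G}\mathbb{N}\times A^{\mathbb{N}}\to A$, $(\mathbf{p},\mathbf{a})\mapsto\sum_{i\in\mathbb{N}}p_ia_i$, such that (1) for $\mathbf{p}=\delta_j$ the value is $a_j$, and (2) $\sum_j p_j(\sum_i Q^j_i a_i)=\sum_i(\sum_j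 p_jQ^j_i)a_i$ for all $\mathbf{p}\in\mathcal{G}\mathbb{N}$, all sequences $\mathbf{Q}:\mathbb{N}\to\mathcal{G}\mathbb{N}$ and all $\mathbf{a}:\mathbb{N}\to A$. A countably affine map is a function $m$ with $m(\sum_i p_ia_i)=\sum_i p_i m(a_i)$ always. Super convex spaces and countably affine maps form the category $\mathbf{SCvx}$. $\Delta_{\mathbb{N}}$ is the set $\mathcal{G}\mathbb{N}$ as a super convex space with countably affine sums taken coefficientwise. $\mathsf{N}$ is the set of natural numbers with super convex structure $\sum_i p_iu_i=\min\{u_i\mid p_i>0\}$. $\mathbf{\Omega}$ is the full subcategory of $\mathbf{SCvx}$ on the two objects $\mathsf{N}$ and $\Delta_{\mathbb{N}}$. $\mathbf{Meas}$ is the category of measurable spaces and measurable maps. $\mathbf{\Sigma}'':\mathbf{\Omega}\to\mathbf{Meas}$ maps $\mathsf{N}\mapsto\mathbb{N}$ and $\Delta_{\mathbb{N}}\mapsto\mathcal{G}\mathbb{N}$ and sends each countably affine map to its underlying function (which is measurable). *)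

theory Defs
  imports "HOL-Analysis.Analysis"
begin

section \<open>Categories, functors, natural transformations, right Kan extensions\<close>

text \<open>
  Hom-sets are indexed by their endpoints, and an arrow does not record them: the same
  \<open>f\<close> may lie in several hom-sets. Composition and the arrow part of a functor are therefore
  indexed by objects; \<open>Comp C a b c g f\<close> is \<open>g\<close> after \<open>f\<close> for \<open>f : a \<rightarrow> b\<close>, \<open>g : b \<rightarrow> c\<close>.
\<close>

record ('o, 'm) category =
  Ob :: "'o set"
  Hom :: "'o \<Rightarrow> 'o \<Rightarrow> 'm set"
  Id :: "'o \<Rightarrow> 'm"
  Comp :: "'o \<Rightarrow> 'o \<Rightarrow> 'o \<Rightarrow> 'm \<Rightarrow> 'm \<Rightarrow> 'm"

definition is_category :: "('o, 'm) category \<Rightarrow> bool" where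
  "is_category C \<longleftrightarrow>
     (\<forall>a\<in>Ob C. Id C a \<in> Hom C a a) \<and>
     (\<forall>a\<in>Ob C. \<forall>b\<in>Ob C. \<forall>c\<in>Ob C. \<forall>f\<in>Hom C a b. \<forall>g\<in>Hom C b c.
        Comp C a b c g f \<in> Hom C a c) \<and>
     (\<forall>a\<in>Ob C. \<forall>b\<in>Ob C. \<forall>f\<in>Hom C a b.
        Comp C a a b f (Id C a) = f \<and> Comp C a b b (Id C b) f = f) \<and>
     (\<forall>a\<in>Ob C. \<forall>b\<in>Ob C. \<forall>c\<in>Ob C. \<forall>d\<in>Ob C.
        \<forall>f\<in>Hom C a b. \<forall>g\<in>Hom C b c. \<forall>h\<in>Hom C c d.
        Comp C a c d h (Comp C a b c g f) = Comp C a b d (Comp C b c d h g) f)"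

definition full_subcategory :: "('o, 'm) category \<Rightarrow> 'o set \<Rightarrow> ('o, 'm) category" where
  "full_subcategory C S = C\<lparr>Ob := Ob C \<inter> S\<rparr>"

record ('o, 'm, 'p, 'n) functor_data =
  FOb :: "'o \<Rightarrow> 'p"
  FHom :: "'o \<Rightarrow> 'o \<Rightarrow> 'm \<Rightarrow> 'n"

definition is_functor ::
  "('o, 'm) category \<Rightarrow> ('p, 'n) category \<Rightarrow> ('o, 'm, 'p, 'n) functor_data \<Rightarrow> bool" where
  "is_functor C D F \<longleftrightarrow>
     is_category C \<and> is_category D \<and>
     (\<forall>a\<in>Ob C. FOb F a \<in> Ob D) \<and>
     (\<forall>a\<in>Ob C. \<forall>b\<in>Ob C. \<forall>f\<in>Hom C a b. FHom F a b f \<in> Hom D (FOb F a) (FOb F b)) \<and>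
     (\<forall>a\<in>Ob C. FHom F a a (Id C a) = Id D (FOb F a)) \<and>
     (\<forall>a\<in>Ob C. \<forall>b\<in>Ob C. \<forall>c\<in>Ob C. \<forall>f\<in>Hom C a b. \<forall>g\<in>Hom C b c.
        FHom F a c (Comp C a b c g f) =
        Comp D (FOb F a) (FOb F b) (FOb F c) (FHom F b c g) (FHom F a b f))"

text \<open>Equality of functors on \<open>C\<close>; the values of the underlying HOL functions off \<open>C\<close> are junk.\<close>

definition functor_eq ::
  "('o, 'm) category \<Rightarrow> ('o, 'm, 'p, 'n) functor_data \<Rightarrow> ('o, 'm, 'p, 'n) functor_data \<Rightarrow> bool" where
  "functor_eq C F G \<longleftrightarrow>
     (\<forall>a\<in>Ob C. FOb F a = FOb G a) \<and>
     (\<forall>a\<in>Ob C. \<forall>b\<in>Ob C. \<forall>f\<in>Hom C a b. FHom F a b f = FHom G a b f)"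

definition functor_comp ::
  "('p, 'n, 'q, 'k) functor_data \<Rightarrow> ('o, 'm, 'p, 'n) functor_data \<Rightarrow> ('o, 'm, 'q, 'k) functor_data" where
  "functor_comp G F =
     \<lparr>FOb = (\<lambda>a. FOb G (FOb F a)),
      FHom = (\<lambda>a b f. FHom G (FOb F a) (FOb F b) (FHom F a b f))\<rparr>"

definition inclusion_functor :: "('o, 'm, 'o, 'm) functor_data" where
  "inclusion_functor = \<lparr>FOb = (\<lambda>a. a), FHom = (\<lambda>a b f. f)\<rparr>"

text \<open>Components are \<open>undefined\<close> off \<open>Ob C\<close>, so that equality of natural transformations is
  equality of functions.\<close>

definition is_nat_trans ::
  "('o, 'm) category \<Rightarrow> ('p, 'n) category \<Rightarrow>
   ('o, 'm, 'p, 'n) functor_data \<Rightarrow> ('o, 'm, 'p, 'n) functor_data \<Rightarrow> ('o \<Rightarrow> 'n) \<Rightarrow> bool" where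
  "is_nat_trans C D F G \<tau> \<longleftrightarrow>
     is_functor C D F \<and> is_functor C D G \<and> \<tau> \<in> extensional (Ob C) \<and>
     (\<forall>a\<in>Ob C. \<tau> a \<in> Hom D (FOb F a) (FOb G a)) \<and>
     (\<forall>a\<in>Ob C. \<forall>b\<in>Ob C. \<forall>f\<in>Hom C a b.
        Comp D (FOb F a) (FOb F b) (FOb G b) (\<tau> b) (FHom F a b f) =
        Comp D (FOb F a) (FOb G a) (FOb G b) (FHom G a b f) (\<tau> a))"

definition nt_vcomp ::
  "('o, 'm) category \<Rightarrow> ('p, 'n) category \<Rightarrow> ('o, 'm, 'p, 'n) functor_data \<Rightarrow>
   ('o, 'm, 'p, 'n) functor_data \<Rightarrow> ('o, 'm, 'p, 'n) functor_data \<Rightarrow>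
   ('o \<Rightarrow> 'n) \<Rightarrow> ('o \<Rightarrow> 'n) \<Rightarrow> ('o \<Rightarrow> 'n)" where
  "nt_vcomp C D F G H \<tau> \<sigma> =
     (\<lambda>a\<in>Ob C. Comp D (FOb F a) (FOb G a) (FOb H a) (\<tau> a) (\<sigma> a))"

definition nt_whisker ::
  "('o, 'm) category \<Rightarrow> ('o, 'm, 'p, 'n) functor_data \<Rightarrow> ('p \<Rightarrow> 'k) \<Rightarrow> ('o \<Rightarrow> 'k)" where
  "nt_whisker M K \<alpha> = (\<lambda>a\<in>Ob M. \<alpha> (FOb K a))"

text \<open>\<open>(R, \<epsilon>)\<close> is a right Kan extension of \<open>T : M \<rightarrow> A\<close> along \<open>K : M \<rightarrow> C\<close>, with universal arrow
  \<open>\<epsilon> : R \<circ> K \<Rightarrow> T\<close>: every \<open>\<gamma> : F \<circ> K \<Rightarrow> T\<close> is \<open>\<epsilon> \<cdot> \<alpha>K\<close> for a unique \<open>\<alpha> : F \<Rightarrow> R\<close>.\<close>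

definition is_right_Kan_extension ::
  "('o, 'm) category \<Rightarrow> ('p, 'n) category \<Rightarrow> ('q, 'k) category \<Rightarrow>
   ('o, 'm, 'p, 'n) functor_data \<Rightarrow> ('o, 'm, 'q, 'k) functor_data \<Rightarrow>
   ('p, 'n, 'q, 'k) functor_data \<Rightarrow> ('o \<Rightarrow> 'k) \<Rightarrow> bool" where
  "is_right_Kan_extension M C A K T R \<epsilon> \<longleftrightarrow>
     is_functor M C K \<and> is_functor M A T \<and> is_functor C A R \<and>
     is_nat_trans M A (functor_comp R K) T \<epsilon> \<and>
     (\<forall>F \<gamma>. is_functor C A F \<and> is_nat_trans M A (functor_comp F K) T \<gamma> \<longrightarrow>
        (\<exists>!\<alpha>. is_nat_trans C A F R \<alpha> \<and>
           nt_vcomp M A (functor_comp F K) (functor_comp R K) T \<epsilon> (nt_whisker M K \<alpha>) = \<gamma>))"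


section \<open>Super convex spaces\<close>

definition GN :: "(nat \<Rightarrow> real) set" where
  "GN = {p. (\<forall>i. p i \<in> {0..1}) \<and> p sums 1}"

definition dirac :: "nat \<Rightarrow> nat \<Rightarrow> real" where
  "dirac j = (\<lambda>i. if i = j then 1 else 0)"

definition mix :: "(nat \<Rightarrow> real) \<Rightarrow> (nat \<Rightarrow> nat \<Rightarrow> real) \<Rightarrow> nat \<Rightarrow> real" where
  "mix p Q = (\<lambda>i. \<Sum>j. p j * Q j i)"

record 'a scvx =
  pts :: "'a set"
  csum :: "(nat \<Rightarrow> real) \<Rightarrow> (nat \<Rightarrow> 'a) \<Rightarrow> 'a"

text \<open>The last conjunct fixes \<open>csum\<close> outside its domain \<open>GN \<times> pts\<^sup>\<nat>\<close>, so that a super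
  convex space is represented by exactly one record.\<close>

definition is_scvx :: "'a scvx \<Rightarrow> bool" where
  "is_scvx A \<longleftrightarrow>
     (\<forall>p\<in>GN. \<forall>a. range a \<subseteq> pts A \<longrightarrow> csum A p a \<in> pts A) \<and>
     (\<forall>j a. range a \<subseteq> pts A \<longrightarrow> csum A (dirac j) a = a j) \<and>
     (\<forall>p\<in>GN. \<forall>Q a. range Q \<subseteq> GN \<and> range a \<subseteq> pts A \<longrightarrow>
        csum A p (\<lambda>j. csum A (Q j) a) = csum A (mix p Q) a) \<and>
     (\<forall>p a. \<not> (p \<in> GN \<and> range a \<subseteq> pts A) \<longrightarrow> csum A p a = undefined)"

definition countably_affine :: "'a scvx \<Rightarrow> 'b scvx \<Rightarrow> ('a \<Rightarrow> 'b) set" where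
  "countably_affine A B =
     {m \<in> pts A \<rightarrow>\<^sub>E pts B. \<forall>p\<in>GN. \<forall>a. range a \<subseteq> pts A \<longrightarrow> m (csum A p a) = csum B p (\<lambda>i. m (a i))}"

definition N_scvx :: "nat scvx" where
  "N_scvx = \<lparr>pts = UNIV, csum = (\<lambda>p u. if p \<in> GN then Inf {u i | i. p i > 0} else undefined)\<rparr>"

definition Delta_scvx :: "(nat \<Rightarrow> real) scvx" where
  "Delta_scvx = \<lparr>pts = GN, csum = (\<lambda>p a. if p \<in> GN \<and> range a \<subseteq> GN then mix p a else undefined)\<rparr>"

text \<open>The copy of \<open>A\<close> along a map \<open>j\<close> that is injective on \<open>pts A\<close>.\<close>

definition embed_scvx :: "('a \<Rightarrow> 'v) \<Rightarrow> 'a scvx \<Rightarrow> 'v scvx" where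
  "embed_scvx j A =
     \<lparr>pts = j ` pts A,
      csum = (\<lambda>p a. if p \<in> GN \<and> range a \<subseteq> j ` pts A
                    then j (csum A p (\<lambda>i. inv_into (pts A) j (a i))) else undefined)\<rparr>"


section \<open>Sizes\<close>

text \<open>
  HOL has no type of all sets, so sets are subsets of a type \<open>'v\<close>, and \<open>\<U>\<close>, \<open>\<V>\<close> say which of them
  are small enough to carry a super convex space, respectively a measurable space.
  The case \<open>\<U> = \<V>\<close> is that of a Grothendieck universe, closed under subsets and, up to
  bijection, under products with \<open>\<nat>\<close> and power sets. Such a family need not exist in HOL without further axioms; allowing
  \<open>\<U> \<noteq> \<V>\<close> makes the conditions satisfiable, with \<open>\<U>\<close> containing a copy of every set of elements
  of any given type \<open>'w\<close> (lemma \<open>universes_exist\<close>).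
\<close>

definition universes :: "'v set set \<Rightarrow> 'v set set \<Rightarrow> bool" where
  "universes \<U> \<V> \<longleftrightarrow>
     \<U> \<subseteq> \<V> \<and>
     (\<forall>B\<in>\<V>. \<forall>A. A \<subseteq> B \<longrightarrow> A \<in> \<V>) \<and>
     (\<forall>A\<in>\<U>. \<exists>B\<in>\<V>. Pow (Pow (A \<times> (UNIV :: nat set))) \<lesssim> B)"

lemma universes_exist:
  "universes {A. A \<subseteq> range (\<lambda>w :: 'w. {{(w, 0 :: nat)}})} (UNIV :: ('w \<times> nat) set set set set)"
proof -
  have "Pow (Pow (A \<times> (UNIV :: nat set))) \<lesssim> (UNIV :: ('w \<times> nat) set set set)"
    if A: "A \<subseteq> range (\<lambda>w :: 'w. {{(w, 0 :: nat)}})" for A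
  proof -
    let ?e = "\<lambda>w :: 'w. {{(w, 0 :: nat)}}"
    have "inj_on (\<lambda>(a, n). (inv ?e a, n)) (A \<times> (UNIV :: nat set))"
      using A by (auto simp: inj_on_def dest: inv_into_injective)
    then have "inj_on (image (image (\<lambda>(a, n). (inv ?e a, n)))) (Pow (Pow (A \<times> (UNIV :: nat set))))"
      by (intro inj_on_image) (simp_all add: inj_on_image_Pow)
    then show ?thesis
      unfolding lepoll_def by blast
  qed
  then show ?thesis
    by (auto simp: universes_def)
qed


section \<open>The categories and functors\<close>

definition SCvx :: "'v set set \<Rightarrow> ('v scvx, 'v \<Rightarrow> 'v) category" where
  "SCvx \<U> =
     \<lparr>Ob = {A. is_scvx A \<and> pts A \<in> \<U>},
      Hom = countably_affine,
      Id = (\<lambda>A. \<lambda>x\<in>pts A. x),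
      Comp = (\<lambda>A B C g f. compose (pts A) g f)\<rparr>"

text \<open>A measurable space is a \<open>measure\<close> whose measure component carries no information.\<close>

definition Meas :: "'v set set \<Rightarrow> ('v measure, 'v \<Rightarrow> 'v) category" where
  "Meas \<V> =
     \<lparr>Ob = {X. space X \<in> \<V> \<and> emeasure X = (\<lambda>_. 0)},
      Hom = (\<lambda>X Y. measurable X Y \<inter> extensional (space X)),
      Id = (\<lambda>X. \<lambda>x\<in>space X. x),
      Comp = (\<lambda>X Y Z g f. compose (space X) g f)\<rparr>"

definition N_meas :: "nat measure" where
  "N_meas = sigma UNIV (Pow UNIV)"

definition ev :: "nat set \<Rightarrow> (nat \<Rightarrow> real) \<Rightarrow> real" where
  "ev W p = (\<Sum>\<^sub>\<infinity>i\<in>W. p i)"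

definition GN_meas :: "(nat \<Rightarrow> real) measure" where
  "GN_meas = sigma GN {ev W -` B \<inter> GN | W B. B \<in> sets borel}"

text \<open>In what follows \<open>jN\<close> and \<open>jD\<close> embed \<open>\<nat>\<close> and \<open>GN\<close> into the type \<open>'v\<close>. The same embeddings
  place the spaces \<open>N\<close>, \<open>\<Delta>\<^sub>\<nat>\<close> and the measurable spaces \<open>\<nat>\<close>, \<open>GN\<close> in \<open>'v\<close>, so the
  functor \<open>Sigma\<close> keeps underlying sets and functions.\<close>

definition N_obj :: "(nat \<Rightarrow> 'v) \<Rightarrow> 'v scvx" where
  "N_obj jN = embed_scvx jN N_scvx"

definition Delta_obj :: "((nat \<Rightarrow> real) \<Rightarrow> 'v) \<Rightarrow> 'v scvx" where
  "Delta_obj jD = embed_scvx jD Delta_scvx"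

definition N_space :: "(nat \<Rightarrow> 'v) \<Rightarrow> 'v measure" where
  "N_space jN = embed_measure N_meas jN"

definition GN_space :: "((nat \<Rightarrow> real) \<Rightarrow> 'v) \<Rightarrow> 'v measure" where
  "GN_space jD = embed_measure GN_meas jD"

definition Omega ::
  "'v set set \<Rightarrow> (nat \<Rightarrow> 'v) \<Rightarrow> ((nat \<Rightarrow> real) \<Rightarrow> 'v) \<Rightarrow> ('v scvx, 'v \<Rightarrow> 'v) category" where
  "Omega \<U> jN jD = full_subcategory (SCvx \<U>) {N_obj jN, Delta_obj jD}"

definition Sigma_functor ::
  "(nat \<Rightarrow> 'v) \<Rightarrow> ((nat \<Rightarrow> real) \<Rightarrow> 'v) \<Rightarrow> ('v scvx, 'v \<Rightarrow> 'v, 'v measure, 'v \<Rightarrow> 'v) functor_data" where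
  "Sigma_functor jN jD =
     \<lparr>FOb = (\<lambda>A. if A = N_obj jN then N_space jN else GN_space jD),
      FHom = (\<lambda>A B f. f)\<rparr>"

end

theory Submission
  imports Defs
begin

text \<open>
  The Kan extension is computed pointwise: its value at a super convex space \<open>c\<close> is the limit of
  \<open>(f : c \<rightarrow> t) \<mapsto> \<Sigma>'' t\<close> over all countably affine maps \<open>f\<close> from \<open>c\<close> to one of the two objects \<open>t\<close> of \<open>\<Omega>\<close>.
  Since \<open>\<Omega>\<close> is a full subcategory, for \<open>c\<close> in \<open>\<Omega>\<close> the index category of this limit has the
  identity of \<open>c\<close> as initial object, so that \<open>\<Sigma>'' c\<close> with the maps \<open>\<Sigma>'' f\<close> is a limit cone
  (\<open>limit_cone_on_subcategory\<close>). Choosing these cones over \<open>\<Omega>\<close> and arbitrary limit cones elsewhere gives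
  a functor that restricts to \<open>\<Sigma>''\<close> exactly, and the universal arrow consists of identities. That
  such a choice of limits is a right Kan extension holds for any full subcategory
  (\<open>Kan_extension\<close> in the locale \<open>pointwise_limits\<close>).

  What remains is particular to super convex spaces. First, \<open>\<Sigma>''\<close> is a functor, that is, countably
  affine maps between the two objects are measurable. A map out of \<open>N\<close> is measurable for trivial
  reasons. A map out of \<open>\<Delta>\<^sub>\<nat>\<close> is determined by its values at the Dirac sequences, which yields
  explicit formulas: a minimum over the support of \<open>p\<close> if the target is \<open>N\<close>, and a series in the
  coefficients of \<open>p\<close> if it is \<open>\<Delta>\<^sub>\<nat>\<close>.

  Second, the limits exist among the measurable spaces on the sets in \<open>\<V>\<close>. The limit at \<open>c\<close> is the set of
  compatible families with the \<open>\<sigma>\<close>-algebra generated by the projections (\<open>limit_cone_in_Meas\<close>), and the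
  condition on \<open>\<U>\<close> and \<open>\<V>\<close> leaves enough room if there are at most as many families as sets of subsets
  of \<open>c \<times> \<nat>\<close>. For nonempty \<open>c\<close> this is a counting argument that encodes points of \<open>N\<close> and \<open>\<Delta>\<^sub>\<nat>\<close> as sets
  of natural numbers (\<open>families_lepoll\<close>). For empty \<open>c\<close> the limit is empty, because the constant
  endomaps of \<open>N\<close> have no common fixed point (\<open>no_compatible_families_on_empty\<close>).
\<close>

section \<open>Right Kan extensions from pointwise limits\<close>

text \<open>
  Cones with vertex \<open>X\<close> over the diagram \<open>(f : c \<rightarrow> t) \<mapsto> T t\<close> indexed by the comma category
  \<open>c \<down> S\<close>, where \<open>S\<close> is a set of objects and stands for the full subcategory on it. The leg at \<open>f\<close>
  takes \<open>t\<close> as a separate argument because an arrow does not determine its codomain.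
\<close>

definition is_cone ::
  "('o, 'm) category \<Rightarrow> 'o set \<Rightarrow> ('q, 'k) category \<Rightarrow> ('o, 'm, 'q, 'k) functor_data \<Rightarrow>
   'o \<Rightarrow> 'q \<Rightarrow> ('o \<Rightarrow> 'm \<Rightarrow> 'k) \<Rightarrow> bool" where
  "is_cone C S D T c X \<kappa> \<longleftrightarrow>
     (\<forall>t\<in>S. \<forall>f\<in>Hom C c t. \<kappa> t f \<in> Hom D X (FOb T t)) \<and>
     (\<forall>t\<in>S. \<forall>t'\<in>S. \<forall>f\<in>Hom C c t. \<forall>h\<in>Hom C t t'.
        Comp D X (FOb T t) (FOb T t') (FHom T t t' h) (\<kappa> t f) = \<kappa> t' (Comp C c t t' h f))"

definition is_limit_cone ::
  "('o, 'm) category \<Rightarrow> 'o set \<Rightarrow> ('q, 'k) category \<Rightarrow> ('o, 'm, 'q, 'k) functor_data \<Rightarrow>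
   'o \<Rightarrow> 'q \<Rightarrow> ('o \<Rightarrow> 'm \<Rightarrow> 'k) \<Rightarrow> bool" where
  "is_limit_cone C S D T c L \<pi> \<longleftrightarrow>
     L \<in> Ob D \<and> is_cone C S D T c L \<pi> \<and>
     (\<forall>X\<in>Ob D. \<forall>\<kappa>. is_cone C S D T c X \<kappa> \<longrightarrow>
        (\<exists>!u. u \<in> Hom D X L \<and>
           (\<forall>t\<in>S. \<forall>f\<in>Hom C c t. Comp D X L (FOb T t) (\<pi> t f) u = \<kappa> t f)))"

lemma
  assumes "is_category C"
  shows category_id: "a \<in> Ob C \<Longrightarrow> Id C a \<in> Hom C a a"
    and category_comp: "\<lbrakk>a \<in> Ob C; b \<in> Ob C; c \<in> Ob C; f \<in> Hom C a b; g \<in> Hom C b c\<rbrakk>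
      \<Longrightarrow> Comp C a b c g f \<in> Hom C a c"
    and category_id_right: "\<lbrakk>a \<in> Ob C; b \<in> Ob C; f \<in> Hom C a b\<rbrakk> \<Longrightarrow> Comp C a a b f (Id C a) = f"
    and category_id_left: "\<lbrakk>a \<in> Ob C; b \<in> Ob C; f \<in> Hom C a b\<rbrakk> \<Longrightarrow> Comp C a b b (Id C b) f = f"
    and category_assoc: "\<lbrakk>a \<in> Ob C; b \<in> Ob C; c \<in> Ob C; d \<in> Ob C;
        f \<in> Hom C a b; g \<in> Hom C b c; h \<in> Hom C c d\<rbrakk>
      \<Longrightarrow> Comp C a c d h (Comp C a b c g f) = Comp C a b d (Comp C b c d h g) f"
  using assms unfolding is_category_def by blast+

lemma
  assumes "is_functor C D F"
  shows functor_category_cod: "is_category D"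
    and functor_ob: "a \<in> Ob C \<Longrightarrow> FOb F a \<in> Ob D"
    and functor_hom: "\<lbrakk>a \<in> Ob C; b \<in> Ob C; f \<in> Hom C a b\<rbrakk> \<Longrightarrow> FHom F a b f \<in> Hom D (FOb F a) (FOb F b)"
    and functor_id: "a \<in> Ob C \<Longrightarrow> FHom F a a (Id C a) = Id D (FOb F a)"
    and functor_compose: "\<lbrakk>a \<in> Ob C; b \<in> Ob C; c \<in> Ob C; f \<in> Hom C a b; g \<in> Hom C b c\<rbrakk> \<Longrightarrow>
        FHom F a c (Comp C a b c g f) =
        Comp D (FOb F a) (FOb F b) (FOb F c) (FHom F b c g) (FHom F a b f)"
  using assms unfolding is_functor_def by blast+

lemma full_subcategory_simps [simp]:
  "Ob (full_subcategory C S) = Ob C \<inter> S"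
  "Hom (full_subcategory C S) = Hom C"
  "Id (full_subcategory C S) = Id C"
  "Comp (full_subcategory C S) = Comp C"
  by (simp_all add: full_subcategory_def)

lemma category_full_subcategory:
  "is_category C \<Longrightarrow> is_category (full_subcategory C S)"
  unfolding is_category_def by simp

lemma inclusion_functor_simps [simp]:
  "FOb inclusion_functor a = a" "FHom inclusion_functor a b f = f"
  by (simp_all add: inclusion_functor_def)

lemma functor_comp_simps [simp]:
  "FOb (functor_comp G F) a = FOb G (FOb F a)"
  "FHom (functor_comp G F) a b f = FHom G (FOb F a) (FOb F b) (FHom F a b f)"
  by (simp_all add: functor_comp_def)

lemma functor_inclusion:
  "is_category C \<Longrightarrow> is_functor (full_subcategory C S) C inclusion_functor"
  using category_full_subcategory[of C S] unfolding is_functor_def by simp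

lemma functor_restrict:
  "is_functor C D F \<Longrightarrow> is_functor (full_subcategory C S) D (functor_comp F inclusion_functor)"
  using category_full_subcategory[of C S] unfolding is_functor_def by simp

text \<open>
  For \<open>t\<close> in the subcategory the identity is initial in \<open>t \<down> S\<close>, so that the limit can be taken to be
  \<open>T t\<close> itself, with legs \<open>T f\<close>; the mediating map of a cone is its leg at the identity.
\<close>

lemma limit_cone_on_subcategory:
  assumes C: "is_category C" and D: "is_category D" and S: "S \<subseteq> Ob C"
    and T: "is_functor (full_subcategory C S) D T" and t: "t \<in> S"
  shows "is_limit_cone C S D T t (FOb T t) (FHom T t)"
  unfolding is_limit_cone_def
proof (intro conjI ballI allI impI)
  have Ob: "a \<in> Ob (full_subcategory C S)" if "a \<in> S" for a using that S by auto
  note F = functor_ob[OF T Ob] functor_hom[OF T Ob Ob, simplified]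
    functor_id[OF T Ob, simplified] functor_compose[OF T Ob Ob Ob, simplified]
  show "FOb T t \<in> Ob D" using F t by blast
  show "is_cone C S D T t (FOb T t) (FHom T t)"
    unfolding is_cone_def using F t by simp
  fix X \<kappa> assume X: "X \<in> Ob D" and k: "is_cone C S D T t X \<kappa>"
  have idt: "Id C t \<in> Hom C t t" using category_id[OF C] S t by blast
  show "\<exists>!u. u \<in> Hom D X (FOb T t) \<and>
          (\<forall>t'\<in>S. \<forall>f\<in>Hom C t t'. Comp D X (FOb T t) (FOb T t') (FHom T t t' f) u = \<kappa> t' f)"
  proof (rule ex1I, intro conjI ballI)
    show "\<kappa> t (Id C t) \<in> Hom D X (FOb T t)" using k t idt unfolding is_cone_def by blast
    fix t' f assume t': "t' \<in> S" and f: "f \<in> Hom C t t'"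
    have "Comp D X (FOb T t) (FOb T t') (FHom T t t' f) (\<kappa> t (Id C t)) = \<kappa> t' (Comp C t t t' f (Id C t))"
      using k t t' f idt unfolding is_cone_def by blast
    then show "Comp D X (FOb T t) (FOb T t') (FHom T t t' f) (\<kappa> t (Id C t)) = \<kappa> t' f"
      using category_id_right[OF C subsetD[OF S t] subsetD[OF S t'] f] by simp
  next
    fix u assume u: "u \<in> Hom D X (FOb T t) \<and>
          (\<forall>t'\<in>S. \<forall>f\<in>Hom C t t'. Comp D X (FOb T t) (FOb T t') (FHom T t t' f) u = \<kappa> t' f)"
    then have "Comp D X (FOb T t) (FOb T t) (FHom T t t (Id C t)) u = \<kappa> t (Id C t)"
      using t idt by blast
    then show "u = \<kappa> t (Id C t)"
      using category_id_left[OF D X] u F t by simp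
  qed
qed

text \<open>
  The action on an arrow \<open>g : a \<rightarrow> b\<close> is the unique map whose composite with the leg at \<open>f\<close> is the
  leg at \<open>f \<circ> g\<close>.
\<close>

definition limit_functor ::
  "('o, 'm) category \<Rightarrow> 'o set \<Rightarrow> ('q, 'k) category \<Rightarrow> ('o, 'm, 'q, 'k) functor_data \<Rightarrow>
   ('o \<Rightarrow> 'q) \<Rightarrow> ('o \<Rightarrow> 'o \<Rightarrow> 'm \<Rightarrow> 'k) \<Rightarrow> ('o, 'm, 'q, 'k) functor_data" where
  "limit_functor C S D T L \<pi> =
     \<lparr>FOb = L,
      FHom = (\<lambda>a b g. THE u. u \<in> Hom D (L a) (L b) \<and>
        (\<forall>t\<in>S. \<forall>f\<in>Hom C b t. Comp D (L a) (L b) (FOb T t) (\<pi> b t f) u = \<pi> a t (Comp C a b t f g)))\<rparr>"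

text \<open>
  The last two assumptions normalise the choice of limits over \<open>S\<close> to the limit cones of
  \<open>limit_cone_on_subcategory\<close>. They make the Kan extension restrict to \<open>T\<close> on the nose, and not
  only up to isomorphism.
\<close>

locale pointwise_limits =
  fixes C :: "('o, 'm) category" and S :: "'o set" and D :: "('q, 'k) category"
    and T :: "('o, 'm, 'q, 'k) functor_data" and L :: "'o \<Rightarrow> 'q" and \<pi> :: "'o \<Rightarrow> 'o \<Rightarrow> 'm \<Rightarrow> 'k"
  assumes C: "is_category C" and S: "S \<subseteq> Ob C"
    and T: "is_functor (full_subcategory C S) D T"
    and limit: "c \<in> Ob C \<Longrightarrow> is_limit_cone C S D T c (L c) (\<pi> c)"
    and L_on: "t \<in> S \<Longrightarrow> L t = FOb T t"
    and \<pi>_on: "\<lbrakk>t \<in> S; t' \<in> S; f \<in> Hom C t t'\<rbrakk> \<Longrightarrow> \<pi> t t' f = FHom T t t' f"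
begin

abbreviation "R \<equiv> limit_functor C S D T L \<pi>"

lemma D: "is_category D" using T by (rule functor_category_cod)

lemma S_Ob: "t \<in> S \<Longrightarrow> t \<in> Ob C" using S by blast

lemma Ob_S [simp]: "Ob C \<inter> S = S" using S by blast

lemma T_ob: "t \<in> S \<Longrightarrow> FOb T t \<in> Ob D"
  using functor_ob[OF T] by simp

lemma L_ob: "c \<in> Ob C \<Longrightarrow> L c \<in> Ob D"
  using limit unfolding is_limit_cone_def by blast

lemma FOb_R [simp]: "FOb R c = L c" by (simp add: limit_functor_def)

lemma proj_hom: "\<lbrakk>c \<in> Ob C; t \<in> S; f \<in> Hom C c t\<rbrakk> \<Longrightarrow> \<pi> c t f \<in> Hom D (L c) (FOb T t)"
  using limit unfolding is_limit_cone_def is_cone_def by blast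

lemma proj_cone: "c \<in> Ob C \<Longrightarrow> is_cone C S D T c (L c) (\<pi> c)"
  using limit unfolding is_limit_cone_def by blast

lemma mediating:
  "\<lbrakk>c \<in> Ob C; X \<in> Ob D; is_cone C S D T c X \<kappa>\<rbrakk> \<Longrightarrow>
    \<exists>!u. u \<in> Hom D X (L c) \<and> (\<forall>t\<in>S. \<forall>f\<in>Hom C c t. Comp D X (L c) (FOb T t) (\<pi> c t f) u = \<kappa> t f)"
  using limit unfolding is_limit_cone_def by blast

lemma cone_precompose:
  assumes c: "c \<in> Ob C" and d: "d \<in> Ob C" and g: "g \<in> Hom C c d"
    and k: "is_cone C S D T c X \<kappa>"
  shows "is_cone C S D T d X (\<lambda>t f. \<kappa> t (Comp C c d t f g))"
  unfolding is_cone_def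
proof (intro conjI ballI)
  show "\<kappa> t (Comp C c d t f g) \<in> Hom D X (FOb T t)" if "t \<in> S" "f \<in> Hom C d t" for t f
    using k that category_comp[OF C c d S_Ob g] unfolding is_cone_def by blast
  fix t t' f h assume t: "t \<in> S" "t' \<in> S" and f: "f \<in> Hom C d t" and h: "h \<in> Hom C t t'"
  show "Comp D X (FOb T t) (FOb T t') (FHom T t t' h) (\<kappa> t (Comp C c d t f g)) =
        \<kappa> t' (Comp C c d t' (Comp C d t t' h f) g)"
    using k t h category_comp[OF C c d S_Ob[OF t(1)] g f] category_assoc[OF C c d S_Ob S_Ob g f h] t
    unfolding is_cone_def by metis
qed

lemma maps_into_limit_eqI:
  assumes c: "c \<in> Ob C" and X: "X \<in> Ob D" and u: "u \<in> Hom D X (L c)" and v: "v \<in> Hom D X (L c)"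
    and eq: "\<And>t f. \<lbrakk>t \<in> S; f \<in> Hom C c t\<rbrakk> \<Longrightarrow>
      Comp D X (L c) (FOb T t) (\<pi> c t f) u = Comp D X (L c) (FOb T t) (\<pi> c t f) v"
  shows "u = v"
proof -
  have "is_cone C S D T c X (\<lambda>t f. Comp D X (L c) (FOb T t) (\<pi> c t f) u)"
    unfolding is_cone_def
  proof (intro conjI ballI)
    show "Comp D X (L c) (FOb T t) (\<pi> c t f) u \<in> Hom D X (FOb T t)" if "t \<in> S" "f \<in> Hom C c t" for t f
      using category_comp[OF D X L_ob T_ob u proj_hom] that c by blast
    fix t t' f h assume t: "t \<in> S" "t' \<in> S" and f: "f \<in> Hom C c t" and h: "h \<in> Hom C t t'"
    have Th: "FHom T t t' h \<in> Hom D (FOb T t) (FOb T t')"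
      using functor_hom[OF T] t h by simp
    have "Comp D (L c) (FOb T t) (FOb T t') (FHom T t t' h) (\<pi> c t f) = \<pi> c t' (Comp C c t t' h f)"
      using proj_cone[OF c] t f h unfolding is_cone_def by blast
    then show "Comp D X (FOb T t) (FOb T t') (FHom T t t' h) (Comp D X (L c) (FOb T t) (\<pi> c t f) u) =
        Comp D X (L c) (FOb T t') (\<pi> c t' (Comp C c t t' h f)) u"
      using category_assoc[OF D X L_ob[OF c] T_ob T_ob u proj_hom[OF c _ f] Th] t by simp
  qed
  from mediating[OF c X this] show ?thesis using u v eq by (metis (no_types, lifting))
qed

lemma
  assumes c: "c \<in> Ob C" and d: "d \<in> Ob C" and g: "g \<in> Hom C c d"
  shows R_hom: "FHom R c d g \<in> Hom D (L c) (L d)"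
    and proj_R: "\<lbrakk>t \<in> S; f \<in> Hom C d t\<rbrakk> \<Longrightarrow>
      Comp D (L c) (L d) (FOb T t) (\<pi> d t f) (FHom R c d g) = \<pi> c t (Comp C c d t f g)"
  using theI'[OF mediating[OF d L_ob[OF c] cone_precompose[OF c d g proj_cone[OF c]]]]
  unfolding limit_functor_def by simp_all

lemma proj_id:
  assumes "t \<in> S" shows "\<pi> t t (Id C t) = Id D (FOb T t)"
  using \<pi>_on[OF assms assms category_id[OF C]] functor_id[OF T] S_Ob assms by simp

text \<open>
  On an arrow into \<open>S\<close>, the functor returns a leg of the limit cone: the leg of the limit cone at the
  identity of \<open>t\<close> is an identity. This turns statements about the legs into naturality statements.
\<close>

lemma R_hom_into_S:
  assumes c: "c \<in> Ob C" and t: "t \<in> S" and f: "f \<in> Hom C c t"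
  shows "FHom R c t f = \<pi> c t f"
proof -
  have tC: "t \<in> Ob C" and idt: "Id C t \<in> Hom C t t"
    using t S_Ob category_id[OF C] by auto
  have "Comp D (L c) (L t) (FOb T t) (Id D (L t)) (FHom R c t f) = \<pi> c t f"
    using proj_R[OF c tC f t idt] proj_id[OF t] category_id_left[OF C c tC f] L_on[OF t] by simp
  then show ?thesis
    using category_id_left[OF D L_ob[OF c] L_ob[OF tC] R_hom[OF c tC f]] L_on[OF t] by simp
qed

lemma functor_R: "is_functor C D R"
  unfolding is_functor_def
proof (intro conjI ballI)
  fix a assume a: "a \<in> Ob C"
  show "FHom R a a (Id C a) = Id D (FOb R a)"
  proof (rule maps_into_limit_eqI[OF a L_ob[OF a] R_hom[OF a a category_id[OF C a]]])
    show "Id D (FOb R a) \<in> Hom D (L a) (L a)"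
      using category_id[OF D L_ob[OF a]] by simp
    fix t f assume t: "t \<in> S" and f: "f \<in> Hom C a t"
    show "Comp D (L a) (L a) (FOb T t) (\<pi> a t f) (FHom R a a (Id C a)) =
        Comp D (L a) (L a) (FOb T t) (\<pi> a t f) (Id D (FOb R a))"
      using proj_R[OF a a category_id[OF C a] t f] category_id_right[OF C a S_Ob[OF t] f]
        category_id_right[OF D L_ob[OF a] T_ob[OF t] proj_hom[OF a t f]] by simp
  qed
next
  fix a b c f g assume a: "a \<in> Ob C" and b: "b \<in> Ob C" and c: "c \<in> Ob C"
    and f: "f \<in> Hom C a b" and g: "g \<in> Hom C b c"
  note gf = category_comp[OF C a b c f g]
  note Rf = R_hom[OF a b f] and Rg = R_hom[OF b c g]
  show "FHom R a c (Comp C a b c g f) = Comp D (FOb R a) (FOb R b) (FOb R c) (FHom R b c g) (FHom R a b f)"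
  proof (rule maps_into_limit_eqI[OF c L_ob[OF a] R_hom[OF a c gf]])
    show "Comp D (FOb R a) (FOb R b) (FOb R c) (FHom R b c g) (FHom R a b f) \<in> Hom D (L a) (L c)"
      using category_comp[OF D L_ob[OF a] L_ob[OF b] L_ob[OF c] Rf Rg] by simp
    fix t h assume t: "t \<in> S" and h: "h \<in> Hom C c t"
    note hg = category_comp[OF C b c S_Ob[OF t] g h]
    show "Comp D (L a) (L c) (FOb T t) (\<pi> c t h) (FHom R a c (Comp C a b c g f)) =
       Comp D (L a) (L c) (FOb T t) (\<pi> c t h)
         (Comp D (FOb R a) (FOb R b) (FOb R c) (FHom R b c g) (FHom R a b f))"
      using category_assoc[OF D L_ob[OF a] L_ob[OF b] L_ob[OF c] T_ob[OF t] Rf Rg proj_hom[OF c t h]]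
        category_assoc[OF C a b c S_Ob[OF t] f g h]
      by (simp add: proj_R[OF a c gf t h] proj_R[OF b c g t h] proj_R[OF a b f t hg])
  qed
qed (use C D L_ob R_hom in auto)

abbreviation "\<epsilon> \<equiv> \<lambda>t\<in>S. Id D (FOb T t)"

lemma R_extends: "functor_eq (full_subcategory C S) (functor_comp R inclusion_functor) T"
  unfolding functor_eq_def using L_on R_hom_into_S S_Ob \<pi>_on by simp

lemma nat_trans_counit:
  "is_nat_trans (full_subcategory C S) D (functor_comp R inclusion_functor) T \<epsilon>"
  unfolding is_nat_trans_def
proof (intro conjI ballI)
  fix a b f assume "a \<in> Ob (full_subcategory C S)" "b \<in> Ob (full_subcategory C S)"
    and f: "f \<in> Hom (full_subcategory C S) a b"
  then have a: "a \<in> S" and b: "b \<in> S" by auto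
  then have "FHom T a b f \<in> Hom D (FOb T a) (FOb T b)"
    using functor_hom[OF T] f by simp
  then show "Comp D (FOb (functor_comp R inclusion_functor) a) (FOb (functor_comp R inclusion_functor) b)
        (FOb T b) (\<epsilon> b) (FHom (functor_comp R inclusion_functor) a b f) =
      Comp D (FOb (functor_comp R inclusion_functor) a) (FOb T a) (FOb T b) (FHom T a b f) (\<epsilon> a)"
    using a b f by (simp add: L_on R_hom_into_S S_Ob \<pi>_on T_ob
        category_id_left[OF D] category_id_right[OF D])
qed (use T functor_restrict[OF functor_R] in \<open>simp_all add: L_on T_ob category_id[OF D]\<close>)

text \<open>
  A transformation \<open>\<gamma> : F \<circ> K \<Rightarrow> T\<close> makes \<open>F c\<close> the vertex of a cone with legs \<open>\<gamma>\<^sub>t \<circ> F f\<close>. Its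
  mediating map into the limit is the component at \<open>c\<close> of the transformation \<open>F \<Rightarrow> R\<close> that \<open>\<gamma>\<close>
  factors through.
\<close>

lemma cone_of_transformation:
  assumes F: "is_functor C D F"
    and g: "is_nat_trans (full_subcategory C S) D (functor_comp F inclusion_functor) T \<gamma>"
    and c: "c \<in> Ob C"
  shows "is_cone C S D T c (FOb F c) (\<lambda>t f. Comp D (FOb F c) (FOb F t) (FOb T t) (\<gamma> t) (FHom F c t f))"
proof -
  have g_hom: "\<gamma> t \<in> Hom D (FOb F t) (FOb T t)" if "t \<in> S" for t
    using g that unfolding is_nat_trans_def by simp
  have g_nat: "Comp D (FOb F t) (FOb F t') (FOb T t') (\<gamma> t') (FHom F t t' h) =
      Comp D (FOb F t) (FOb T t) (FOb T t') (FHom T t t' h) (\<gamma> t)"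
    if "t \<in> S" "t' \<in> S" "h \<in> Hom C t t'" for t t' h
    using g that unfolding is_nat_trans_def by simp
  show ?thesis
    unfolding is_cone_def
  proof (intro conjI ballI)
    show "Comp D (FOb F c) (FOb F t) (FOb T t) (\<gamma> t) (FHom F c t f) \<in> Hom D (FOb F c) (FOb T t)"
      if t: "t \<in> S" and f: "f \<in> Hom C c t" for t f
      using category_comp[OF D functor_ob[OF F c] functor_ob[OF F S_Ob[OF t]] T_ob[OF t]
          functor_hom[OF F c S_Ob[OF t] f] g_hom[OF t]] .
    fix t t' f h assume t: "t \<in> S" and t': "t' \<in> S" and f: "f \<in> Hom C c t" and h: "h \<in> Hom C t t'"
    note FO = functor_ob[OF F c] functor_ob[OF F S_Ob[OF t]]
    note Ff = functor_hom[OF F c S_Ob[OF t] f] and Fh = functor_hom[OF F S_Ob[OF t] S_Ob[OF t'] h]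
    have Th: "FHom T t t' h \<in> Hom D (FOb T t) (FOb T t')"
      using functor_hom[OF T] t t' h by simp
    show "Comp D (FOb F c) (FOb T t) (FOb T t') (FHom T t t' h)
            (Comp D (FOb F c) (FOb F t) (FOb T t) (\<gamma> t) (FHom F c t f)) =
          Comp D (FOb F c) (FOb F t') (FOb T t') (\<gamma> t') (FHom F c t' (Comp C c t t' h f))"
      using category_assoc[OF D FO T_ob[OF t] T_ob[OF t'] Ff g_hom[OF t] Th]
        category_assoc[OF D FO functor_ob[OF F S_Ob[OF t']] T_ob[OF t'] Ff Fh g_hom[OF t']]
        g_nat[OF t t' h] functor_compose[OF F c S_Ob[OF t] S_Ob[OF t'] f h]
      by simp
  qed
qed

text \<open>
  As \<open>\<epsilon>\<close> consists of identities, factoring through it means restricting to \<open>S\<close>.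
\<close>

lemma counit_vcomp_whisker_eq_iff:
  assumes F: "is_functor C D F" and a: "is_nat_trans C D F R \<alpha>"
    and g: "is_nat_trans (full_subcategory C S) D (functor_comp F inclusion_functor) T \<gamma>"
  shows "nt_vcomp (full_subcategory C S) D (functor_comp F inclusion_functor)
      (functor_comp R inclusion_functor) T \<epsilon> (nt_whisker (full_subcategory C S) inclusion_functor \<alpha>) = \<gamma>
    \<longleftrightarrow> (\<forall>t\<in>S. \<alpha> t = \<gamma> t)" (is "?lhs = \<gamma> \<longleftrightarrow> _")
proof -
  have on: "?lhs t = \<alpha> t" if t: "t \<in> S" for t
  proof -
    have "\<alpha> t \<in> Hom D (FOb F t) (FOb T t)"
      using a t S_Ob[OF t] L_on[OF t] unfolding is_nat_trans_def by (metis FOb_R)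
    then show ?thesis
      using t category_id_left[OF D functor_ob[OF F S_Ob[OF t]] T_ob[OF t]]
      by (simp add: nt_vcomp_def nt_whisker_def L_on)
  qed
  have off: "?lhs t = \<gamma> t" if "t \<notin> S" for t
    using g that unfolding is_nat_trans_def by (simp add: extensional_def nt_vcomp_def)
  show ?thesis
  proof
    show "\<forall>t\<in>S. \<alpha> t = \<gamma> t" if "?lhs = \<gamma>" using on that by metis
    show "?lhs = \<gamma>" if "\<forall>t\<in>S. \<alpha> t = \<gamma> t"
    proof (rule ext)
      show "?lhs t = \<gamma> t" for t using on off that by (cases "t \<in> S") metis+
    qed
  qed
qed

text \<open>
  If \<open>\<alpha> : F \<Rightarrow> R\<close> agrees with \<open>\<gamma>\<close> on \<open>S\<close>, then naturality at \<open>f : c \<rightarrow> t\<close> says that the leg at \<open>f\<close> after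
  \<open>\<alpha>\<^sub>c\<close> is \<open>\<gamma>\<^sub>t \<circ> F f\<close>. This determines \<open>\<alpha>\<^sub>c\<close>, and conversely serves to define it.
\<close>

theorem Kan_extension:
  "is_right_Kan_extension (full_subcategory C S) C D inclusion_functor T R \<epsilon>"
  unfolding is_right_Kan_extension_def
proof (intro conjI allI impI)
  fix F \<gamma>
  assume "is_functor C D F \<and> is_nat_trans (full_subcategory C S) D (functor_comp F inclusion_functor) T \<gamma>"
  then have F: "is_functor C D F"
    and g: "is_nat_trans (full_subcategory C S) D (functor_comp F inclusion_functor) T \<gamma>" by auto
  note cone = cone_of_transformation[OF F g]
  have g_hom: "\<gamma> t \<in> Hom D (FOb F t) (FOb T t)" if "t \<in> S" for t
    using g that unfolding is_nat_trans_def by simp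
  \<comment> \<open>\<open>P c u\<close>: \<open>u\<close> mediates between the cone with legs \<open>\<gamma>\<^sub>t \<circ> F f\<close> and the limit cone at \<open>c\<close>.\<close>
  define P where "P c u \<longleftrightarrow> u \<in> Hom D (FOb F c) (L c) \<and> (\<forall>t\<in>S. \<forall>f\<in>Hom C c t.
      Comp D (FOb F c) (L c) (FOb T t) (\<pi> c t f) u = Comp D (FOb F c) (FOb F t) (FOb T t) (\<gamma> t) (FHom F c t f))"
    for c u
  have P_ex1: "\<exists>!u. P c u" if c: "c \<in> Ob C" for c
    unfolding P_def by (rule mediating[OF c functor_ob[OF F c] cone[OF c]])
  have P_nat: "P c (\<alpha> c)" if a: "is_nat_trans C D F R \<alpha>" and ag: "\<forall>t\<in>S. \<alpha> t = \<gamma> t" and c: "c \<in> Ob C" for \<alpha> c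
    unfolding P_def
  proof (intro conjI ballI)
    show "\<alpha> c \<in> Hom D (FOb F c) (L c)"
      using a c unfolding is_nat_trans_def by simp
    fix t f assume t: "t \<in> S" and f: "f \<in> Hom C c t"
    have "Comp D (FOb F c) (FOb F t) (FOb R t) (\<alpha> t) (FHom F c t f) =
        Comp D (FOb F c) (FOb R c) (FOb R t) (FHom R c t f) (\<alpha> c)"
      using a c S_Ob[OF t] f unfolding is_nat_trans_def by blast
    then show "Comp D (FOb F c) (L c) (FOb T t) (\<pi> c t f) (\<alpha> c) =
        Comp D (FOb F c) (FOb F t) (FOb T t) (\<gamma> t) (FHom F c t f)"
      using ag t R_hom_into_S[OF c t f] by (simp add: L_on)
  qed
  define \<alpha> where "\<alpha> = (\<lambda>c\<in>Ob C. THE u. P c u)"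
  have P\<alpha>: "P c (\<alpha> c)" if "c \<in> Ob C" for c
    using theI'[OF P_ex1[OF that]] that by (simp add: \<alpha>_def)
  then have \<alpha>_hom: "\<alpha> c \<in> Hom D (FOb F c) (L c)" if "c \<in> Ob C" for c
    using that unfolding P_def by blast
  have \<alpha>_proj: "Comp D (FOb F c) (L c) (FOb T t) (\<pi> c t f) (\<alpha> c) =
      Comp D (FOb F c) (FOb F t) (FOb T t) (\<gamma> t) (FHom F c t f)"
    if "c \<in> Ob C" "t \<in> S" "f \<in> Hom C c t" for c t f
    using P\<alpha> that unfolding P_def by blast
  have \<alpha>_on: "\<alpha> t = \<gamma> t" if t: "t \<in> S" for t
  proof -
    note tC = S_Ob[OF t]
    have "Comp D (FOb F t) (L t) (FOb T t) (Id D (L t)) (\<alpha> t) =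
        Comp D (FOb F t) (FOb F t) (FOb T t) (\<gamma> t) (Id D (FOb F t))"
      using \<alpha>_proj[OF tC t category_id[OF C tC]] proj_id[OF t] functor_id[OF F tC] L_on[OF t] by simp
    then show ?thesis
      using category_id_left[OF D functor_ob[OF F tC] L_ob[OF tC] \<alpha>_hom[OF tC]]
        category_id_right[OF D functor_ob[OF F tC] T_ob[OF t] g_hom[OF t]] L_on[OF t] by simp
  qed
  have nat: "is_nat_trans C D F R \<alpha>"
    unfolding is_nat_trans_def
  proof (intro conjI ballI)
    show "\<alpha> \<in> extensional (Ob C)" by (simp add: \<alpha>_def)
    fix a b f assume a: "a \<in> Ob C" and b: "b \<in> Ob C" and f: "f \<in> Hom C a b"
    note Fa = functor_ob[OF F a] and Fb = functor_ob[OF F b] and Ff = functor_hom[OF F a b f]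
    show "Comp D (FOb F a) (FOb F b) (FOb R b) (\<alpha> b) (FHom F a b f) =
        Comp D (FOb F a) (FOb R a) (FOb R b) (FHom R a b f) (\<alpha> a)"
    proof (rule maps_into_limit_eqI[OF b Fa])
      fix t h assume t: "t \<in> S" and h: "h \<in> Hom C b t"
      note Ft = functor_ob[OF F S_Ob[OF t]]
      show "Comp D (FOb F a) (L b) (FOb T t) (\<pi> b t h)
              (Comp D (FOb F a) (FOb F b) (FOb R b) (\<alpha> b) (FHom F a b f)) =
            Comp D (FOb F a) (L b) (FOb T t) (\<pi> b t h)
              (Comp D (FOb F a) (FOb R a) (FOb R b) (FHom R a b f) (\<alpha> a))"
        using category_assoc[OF D Fa Fb L_ob[OF b] T_ob[OF t] Ff \<alpha>_hom[OF b] proj_hom[OF b t h]]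
          category_assoc[OF D Fa L_ob[OF a] L_ob[OF b] T_ob[OF t] \<alpha>_hom[OF a] R_hom[OF a b f] proj_hom[OF b t h]]
          category_assoc[OF D Fa Fb Ft T_ob[OF t] Ff functor_hom[OF F b S_Ob[OF t] h] g_hom[OF t]]
          \<alpha>_proj[OF b t h] \<alpha>_proj[OF a t category_comp[OF C a b S_Ob[OF t] f h]]
          functor_compose[OF F a b S_Ob[OF t] f h] proj_R[OF a b f t h]
        by simp
    qed (use category_comp[OF D Fa Fb L_ob[OF b] Ff \<alpha>_hom[OF b]]
          category_comp[OF D Fa L_ob[OF a] L_ob[OF b] \<alpha>_hom[OF a] R_hom[OF a b f]] in simp_all)
  qed (use F functor_R \<alpha>_hom in auto)
  show "\<exists>!\<alpha>. is_nat_trans C D F R \<alpha> \<and>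
      nt_vcomp (full_subcategory C S) D (functor_comp F inclusion_functor) (functor_comp R inclusion_functor) T \<epsilon>
        (nt_whisker (full_subcategory C S) inclusion_functor \<alpha>) = \<gamma>"
  proof (rule ex1I)
    show "is_nat_trans C D F R \<alpha> \<and>
      nt_vcomp (full_subcategory C S) D (functor_comp F inclusion_functor) (functor_comp R inclusion_functor) T \<epsilon>
        (nt_whisker (full_subcategory C S) inclusion_functor \<alpha>) = \<gamma>"
      using nat \<alpha>_on counit_vcomp_whisker_eq_iff[OF F nat g] by blast
  next
    fix \<beta> assume b: "is_nat_trans C D F R \<beta> \<and>
      nt_vcomp (full_subcategory C S) D (functor_comp F inclusion_functor) (functor_comp R inclusion_functor) T \<epsilon>
        (nt_whisker (full_subcategory C S) inclusion_functor \<beta>) = \<gamma>"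
    then have "\<forall>t\<in>S. \<beta> t = \<gamma> t"
      using counit_vcomp_whisker_eq_iff[OF F _ g] by blast
    then have "\<beta> c = \<alpha> c" if "c \<in> Ob C" for c
      using P_ex1[OF that] P_nat[of \<beta> c] P\<alpha>[OF that] b that by blast
    moreover have "\<beta> c = \<alpha> c" if "c \<notin> Ob C" for c
      using b that unfolding is_nat_trans_def by (simp add: extensional_def \<alpha>_def)
    ultimately show "\<beta> = \<alpha>" by blast
  qed
qed (use functor_inclusion[OF C] T functor_R nat_trans_counit in auto)

end

section \<open>Probability sequences\<close>

lemma GN_iff_has_sum: "p \<in> GN \<longleftrightarrow> (\<forall>i. 0 \<le> p i) \<and> (p has_sum 1) UNIV"
proof (intro iffI conjI)
  assume p: "(\<forall>i. 0 \<le> p i) \<and> (p has_sum 1) UNIV"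
  have "p i \<le> 1" for i
  proof -
    have "(p has_sum p i) {i}" using has_sum_finite[of "{i}" p] by simp
    then show ?thesis using p by (intro has_sum_mono_neutral[of p "{i}" "p i" p UNIV 1]) auto
  qed
  then show "p \<in> GN" using p has_sum_imp_sums by (auto simp: GN_def)
qed (auto simp: GN_def intro: sums_nonneg_imp_has_sum)

lemma
  assumes "p \<in> GN"
  shows GN_nonneg: "0 \<le> p i" and GN_le_1: "p i \<le> 1" and GN_summable: "p summable_on UNIV"
  using assms GN_iff_has_sum[of p] by (auto simp: GN_def intro: has_sum_imp_summable)

lemma has_sum_pairing:
  assumes p: "p \<in> GN" and g: "\<And>i. 0 \<le> g i" "\<And>i. g i \<le> 1"
  shows "((\<lambda>i. p i * g i) has_sum (\<Sum>\<^sub>\<infinity>i. p i * g i)) UNIV"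
proof -
  have "(\<lambda>i. p i * g i) summable_on UNIV"
    by (rule summable_on_comparison_test[OF GN_summable[OF p]])
      (use GN_nonneg[OF p] g in \<open>auto intro: mult_left_le\<close>)
  then show ?thesis by (rule has_sum_infsum)
qed

lemma pairing_bounds:
  assumes p: "p \<in> GN" and g: "\<And>i. 0 \<le> g i" "\<And>i. g i \<le> 1"
  shows "0 \<le> (\<Sum>\<^sub>\<infinity>i. p i * g i)" "(\<Sum>\<^sub>\<infinity>i. p i * g i) \<le> 1"
proof -
  show "0 \<le> (\<Sum>\<^sub>\<infinity>i. p i * g i)" using GN_nonneg[OF p] g by (simp add: infsum_nonneg)
  show "(\<Sum>\<^sub>\<infinity>i. p i * g i) \<le> 1"
    by (rule has_sum_mono[OF has_sum_pairing[OF p g]])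
      (use GN_iff_has_sum[of p] p g GN_nonneg[OF p] in \<open>auto intro: mult_left_le\<close>)
qed

lemma mix_eq_infsum:
  assumes p: "p \<in> GN" and Q: "\<And>j. Q j \<in> GN"
  shows "mix p Q i = (\<Sum>\<^sub>\<infinity>j. p j * Q j i)"
  unfolding mix_def
  using has_sum_imp_sums[OF has_sum_pairing[OF p, of "\<lambda>j. Q j i"]] GN_nonneg[OF Q] GN_le_1[OF Q]
  by (simp add: sums_iff)

text \<open>
  Tonelli for the double series \<open>p\<^sub>j Q\<^sup>j\<^sub>i g\<^sub>i\<close>. The three cases of use are \<open>g = 1\<close> (a mixture is again a
  probability sequence), \<open>g\<close> a coefficient of a sequence in \<open>GN\<close> (associativity of mixing) and \<open>g\<close> an
  indicator function (evaluations are countably affine).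
\<close>

lemma has_sum_mix_pairing:
  assumes p: "p \<in> GN" and Q: "\<And>j. Q j \<in> GN" and g: "\<And>i. 0 \<le> g i" "\<And>i. g i \<le> 1"
  shows "((\<lambda>i. mix p Q i * g i) has_sum (\<Sum>\<^sub>\<infinity>j. p j * (\<Sum>\<^sub>\<infinity>i. Q j i * g i))) UNIV"
proof -
  let ?e = "\<lambda>j. \<Sum>\<^sub>\<infinity>i. Q j i * g i"
  let ?s = "\<lambda>(j, i). p j * Q j i * g i"
  have inner: "((\<lambda>i. ?s (j, i)) has_sum p j * ?e j) UNIV" for j
    using has_sum_cmult_right[OF has_sum_pairing[OF Q g], where c = "p j"] by (simp add: mult.assoc)
  have outer: "((\<lambda>j. p j * ?e j) has_sum (\<Sum>\<^sub>\<infinity>j. p j * ?e j)) UNIV"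
    by (rule has_sum_pairing[OF p pairing_bounds[OF Q g]])
  have "?s summable_on UNIV \<times> UNIV"
    by (rule summable_on_SigmaI[OF inner has_sum_imp_summable[OF outer]])
      (use GN_nonneg[OF p] GN_nonneg[OF Q] g in auto)
  then have "(?s has_sum (\<Sum>\<^sub>\<infinity>j. p j * ?e j)) (UNIV \<times> UNIV)"
    by (intro has_sum_SigmaI[OF inner outer])
  then have "((\<lambda>(i, j). ?s (j, i)) has_sum (\<Sum>\<^sub>\<infinity>j. p j * ?e j)) (UNIV \<times> UNIV)"
    by (subst (asm) has_sum_swap)
  then show ?thesis
  proof (rule has_sum_SigmaD)
    fix i
    have "((\<lambda>j. p j * Q j i) has_sum mix p Q i) UNIV"
      unfolding mix_eq_infsum[of p Q, OF p Q]
      using GN_nonneg[OF Q] GN_le_1[OF Q] by (intro has_sum_pairing[OF p])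
    then show "((\<lambda>j. case (i, j) of (i, j) \<Rightarrow> ?s (j, i)) has_sum mix p Q i * g i) UNIV"
      using has_sum_cmult_left by fastforce
  qed
qed

lemma mix_nonneg:
  assumes "p \<in> GN" and "\<And>j. Q j \<in> GN"
  shows "0 \<le> mix p Q i"
  unfolding mix_eq_infsum[of p Q, OF assms]
  using GN_nonneg[OF assms(1)] GN_nonneg[OF assms(2)] by (simp add: infsum_nonneg)

lemma mix_in_GN:
  assumes p: "p \<in> GN" and Q: "\<And>j. Q j \<in> GN"
  shows "mix p Q \<in> GN"
proof -
  have "(\<Sum>\<^sub>\<infinity>i. Q j i) = 1" for j
    using Q GN_iff_has_sum by (blast intro: infsumI)
  moreover have "(\<Sum>\<^sub>\<infinity>j. p j) = 1"
    using p GN_iff_has_sum by (blast intro: infsumI)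
  ultimately have "(mix p Q has_sum 1) UNIV"
    using has_sum_mix_pairing[OF p Q, of "\<lambda>_. 1"] by simp
  then show ?thesis
    unfolding GN_iff_has_sum using mix_nonneg[of p Q, OF p Q] by blast
qed

text \<open>
  The support of a mixture is the union of the supports of the sequences of positive weight. This gives
  the associativity law for the minimum structure on the natural numbers.
\<close>

lemma mix_pos_iff:
  assumes p: "p \<in> GN" and Q: "\<And>j. Q j \<in> GN"
  shows "0 < mix p Q i \<longleftrightarrow> (\<exists>j. 0 < p j \<and> 0 < Q j i)"
proof -
  have nonneg: "0 \<le> p j * Q j i" for j
    using GN_nonneg[OF p] GN_nonneg[OF Q] by simp
  have "summable (\<lambda>j. p j * Q j i)"
    using has_sum_imp_sums[OF has_sum_pairing[OF p, of "\<lambda>j. Q j i"]] GN_nonneg[OF Q] GN_le_1[OF Q]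
    by (simp add: sums_iff)
  moreover have "0 < p j * Q j i \<longleftrightarrow> 0 < p j \<and> 0 < Q j i" for j
    using GN_nonneg[OF p, of j] GN_nonneg[OF Q, of j i] by (auto simp: zero_less_mult_iff)
  ultimately show ?thesis
    unfolding mix_def using suminf_pos_iff[OF _ nonneg] by simp
qed

lemma mix_mix:
  assumes p: "p \<in> GN" and Q: "\<And>j. Q j \<in> GN" and a: "\<And>i. a i \<in> GN"
  shows "mix p (\<lambda>j. mix (Q j) a) = mix (mix p Q) a"
proof
  fix k
  have "mix (mix p Q) a k = (\<Sum>\<^sub>\<infinity>i. mix p Q i * a i k)"
    by (rule mix_eq_infsum[OF mix_in_GN[of p Q, OF p Q] a])
  also have "\<dots> = (\<Sum>\<^sub>\<infinity>j. p j * (\<Sum>\<^sub>\<infinity>i. Q j i * a i k))"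
    by (rule infsumI[OF has_sum_mix_pairing[OF p Q GN_nonneg[OF a] GN_le_1[OF a]]])
  also have "\<dots> = mix p (\<lambda>j. mix (Q j) a) k"
    by (subst mix_eq_infsum[OF p mix_in_GN[OF Q a]]) (simp add: mix_eq_infsum[OF Q a])
  finally show "mix p (\<lambda>j. mix (Q j) a) k = mix (mix p Q) a k" by simp
qed

lemma dirac_in_GN: "dirac j \<in> GN"
  using sums_single[of j "\<lambda>_. 1 :: real"] by (simp add: GN_def dirac_def)

lemma dirac_pos_iff [simp]: "0 < dirac j i \<longleftrightarrow> i = j"
  by (simp add: dirac_def)

lemma mix_dirac_left: "mix (dirac j) a = a j"
proof
  fix i
  have "(\<lambda>k. dirac j k * a k i) = (\<lambda>k. if k = j then a k i else 0)"
    by (auto simp: dirac_def)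
  then show "mix (dirac j) a i = a j i"
    unfolding mix_def using sums_single[of j "\<lambda>k. a k i"] by (simp add: sums_iff)
qed

lemma mix_dirac_right: "mix p dirac = p"
proof
  fix i
  have "(\<lambda>k. p k * dirac k i) = (\<lambda>k. if k = i then p k else 0)"
    by (auto simp: dirac_def)
  then show "mix p dirac i = p i"
    unfolding mix_def using sums_single[of i p] by (simp add: sums_iff)
qed

lemma ev_mix:
  assumes p: "p \<in> GN" and Q: "\<And>j. Q j \<in> GN"
  shows "ev W (mix p Q) = (\<Sum>j. p j * ev W (Q j))"
proof -
  have ev_pairing: "ev W q = (\<Sum>\<^sub>\<infinity>i. q i * indicator W i)" for q
    unfolding ev_def by (rule infsum_cong_neutral) (auto simp: indicator_def)
  have e: "0 \<le> ev W (Q j)" "ev W (Q j) \<le> 1" for j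
    unfolding ev_pairing by (rule pairing_bounds[OF Q]; simp)+
  have "ev W (mix p Q) = (\<Sum>\<^sub>\<infinity>j. p j * ev W (Q j))"
    unfolding ev_pairing by (rule infsumI[OF has_sum_mix_pairing[OF p Q]]) simp_all
  also have "\<dots> = (\<Sum>j. p j * ev W (Q j))"
    using has_sum_imp_sums[OF has_sum_pairing[OF p e]] by (simp add: sums_iff)
  finally show ?thesis .
qed

section \<open>The super convex spaces\<close>

lemma N_scvx_simps [simp]: "pts N_scvx = UNIV" "p \<in> GN \<Longrightarrow> csum N_scvx p u = Inf {u i | i. 0 < p i}"
  by (simp_all add: N_scvx_def)

lemma Delta_scvx_simps [simp]:
  "pts Delta_scvx = GN" "\<lbrakk>p \<in> GN; range a \<subseteq> GN\<rbrakk> \<Longrightarrow> csum Delta_scvx p a = mix p a"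
  by (simp_all add: Delta_scvx_def)

lemma GN_support: "p \<in> GN \<Longrightarrow> \<exists>i. 0 < p i"
proof (rule ccontr)
  assume p: "p \<in> GN" and "\<not> (\<exists>i. 0 < p i)"
  then have "p = (\<lambda>_. 0)" using GN_nonneg[OF p] by (auto simp: order_less_le)
  then show False using p by (auto simp: GN_def sums_iff)
qed

lemma scvx_N: "is_scvx N_scvx"
  unfolding is_scvx_def
proof (intro conjI ballI allI impI)
  show "csum N_scvx (dirac j) a = a j" for j a
    using dirac_in_GN by simp
  show "csum N_scvx p a = undefined" if "\<not> (p \<in> GN \<and> range a \<subseteq> pts N_scvx)" for p a
    using that by (simp add: N_scvx_def)
  fix p and a :: "nat \<Rightarrow> nat" and Q :: "nat \<Rightarrow> nat \<Rightarrow> real" assume p: "p \<in> GN" and "range Q \<subseteq> GN \<and> range a \<subseteq> pts N_scvx"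
  then have Q: "Q j \<in> GN" for j by auto
  let ?X = "\<lambda>j. {a i | i. 0 < Q j i}"
  have ne: "?X j \<noteq> {}" for j using GN_support[OF Q] by blast
  have "Inf {Inf (?X j) | j. 0 < p j} = Inf {a i | i. 0 < mix p Q i}"
  proof (rule antisym)
    have "Inf {a i | i. 0 < mix p Q i} \<in> {a i | i. 0 < mix p Q i}"
      using GN_support[OF mix_in_GN[of p Q, OF p Q]] by (intro Inf_nat_def1) blast
    then obtain i j where i: "Inf {a i | i. 0 < mix p Q i} = a i" "0 < p j" "0 < Q j i"
      using mix_pos_iff[of p Q, OF p Q] by auto
    then have "Inf {Inf (?X j) | j. 0 < p j} \<le> Inf (?X j)"
      by (intro cInf_lower) auto
    also have "\<dots> \<le> a i" using i by (intro cInf_lower) auto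
    finally show "Inf {Inf (?X j) | j. 0 < p j} \<le> Inf {a i | i. 0 < mix p Q i}" using i by simp
  next
    have "Inf {Inf (?X j) | j. 0 < p j} \<in> {Inf (?X j) | j. 0 < p j}"
      using GN_support[OF p] by (intro Inf_nat_def1) blast
    then obtain j where j: "Inf {Inf (?X j) | j. 0 < p j} = Inf (?X j)" "0 < p j" by auto
    obtain i where "Inf (?X j) = a i" "0 < Q j i"
      using Inf_nat_def1[OF ne[of j]] by auto
    then have "Inf (?X j) \<in> {a i | i. 0 < mix p Q i}"
      using j mix_pos_iff[of p Q, OF p Q] by auto
    then show "Inf {a i | i. 0 < mix p Q i} \<le> Inf {Inf (?X j) | j. 0 < p j}"
      unfolding j by (intro cInf_lower) auto
  qed
  then show "csum N_scvx p (\<lambda>j. csum N_scvx (Q j) a) = csum N_scvx (mix p Q) a"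
    using p Q mix_in_GN[of p Q, OF p Q] by simp
qed simp

lemma scvx_Delta: "is_scvx Delta_scvx"
  unfolding is_scvx_def
proof (intro conjI ballI allI impI)
  show "csum Delta_scvx p a \<in> pts Delta_scvx" if "p \<in> GN" "range a \<subseteq> pts Delta_scvx" for p a
    using that mix_in_GN[of p a] by auto
  show "csum Delta_scvx (dirac j) a = a j" if "range a \<subseteq> pts Delta_scvx" for j a
    using that dirac_in_GN by (simp add: mix_dirac_left)
  show "csum Delta_scvx p a = undefined" if "\<not> (p \<in> GN \<and> range a \<subseteq> pts Delta_scvx)" for p a
    using that by (auto simp: Delta_scvx_def)
  fix p and Q a :: "nat \<Rightarrow> nat \<Rightarrow> real" assume p: "p \<in> GN" and "range Q \<subseteq> GN \<and> range a \<subseteq> pts Delta_scvx"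
  then have Q: "Q j \<in> GN" and a: "a j \<in> GN" for j by auto
  then show "csum Delta_scvx p (\<lambda>j. csum Delta_scvx (Q j) a) = csum Delta_scvx (mix p Q) a"
    using p mix_in_GN[of p Q, OF p Q] mix_in_GN[of _ a, OF Q a] mix_mix[of p Q a, OF p Q a]
    by (simp add: image_subset_iff)
qed

lemma pts_embed_scvx [simp]: "pts (embed_scvx j A) = j ` pts A"
  by (simp add: embed_scvx_def)

lemma csum_embed_scvx:
  assumes "inj_on j (pts A)" "p \<in> GN" "\<And>i. b i \<in> pts A"
  shows "csum (embed_scvx j A) p (\<lambda>i. j (b i)) = j (csum A p b)"
  using assms by (auto simp: embed_scvx_def inv_into_f_f)

lemma family_in_image:
  assumes "range a \<subseteq> j ` X"
  obtains b where "\<And>i. b i \<in> X" "a = (\<lambda>i. j (b i))"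
proof -
  have "\<forall>i. \<exists>x\<in>X. a i = j x" using assms by blast
  then show ?thesis using that by metis
qed

lemma scvx_embed:
  assumes A: "is_scvx A" and j: "inj_on j (pts A)"
  shows "is_scvx (embed_scvx j A)"
proof -
  have A_closed: "csum A p b \<in> pts A" if "p \<in> GN" "\<And>i. b i \<in> pts A" for p b
    using A that unfolding is_scvx_def by (simp add: image_subset_iff)
  have A_dirac: "csum A (dirac k) b = b k" if "\<And>i. b i \<in> pts A" for k b
    using A that unfolding is_scvx_def by (simp add: image_subset_iff)
  have A_assoc: "csum A p (\<lambda>j. csum A (Q j) b) = csum A (mix p Q) b"
    if "p \<in> GN" "\<And>j. Q j \<in> GN" "\<And>i. b i \<in> pts A" for p Q b
    using A that unfolding is_scvx_def by (simp add: image_subset_iff)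
  show ?thesis
    unfolding is_scvx_def pts_embed_scvx
  proof (intro conjI ballI allI impI)
    fix p and a :: "nat \<Rightarrow> _" assume p: "p \<in> GN" and a: "range a \<subseteq> j ` pts A"
    obtain b where b: "\<And>i. b i \<in> pts A" "a = (\<lambda>i. j (b i))" using family_in_image[OF a] by blast
    then show "csum (embed_scvx j A) p a \<in> j ` pts A"
      using csum_embed_scvx[of j A p b, OF j p] A_closed[of p b] p by simp
  next
    fix k and a :: "nat \<Rightarrow> _" assume "range a \<subseteq> j ` pts A"
    then obtain b where b: "\<And>i. b i \<in> pts A" "a = (\<lambda>i. j (b i))" using family_in_image by blast
    then show "csum (embed_scvx j A) (dirac k) a = a k"
      using csum_embed_scvx[of j A _ b, OF j dirac_in_GN] A_dirac[of b] by simp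
  next
    fix p and a :: "nat \<Rightarrow> _" and Q :: "nat \<Rightarrow> nat \<Rightarrow> real" assume p: "p \<in> GN" and Qa: "range Q \<subseteq> GN \<and> range a \<subseteq> j ` pts A"
    then obtain b where b: "\<And>i. b i \<in> pts A" "a = (\<lambda>i. j (b i))" using family_in_image by blast
    have Q: "Q k \<in> GN" for k using Qa by blast
    show "csum (embed_scvx j A) p (\<lambda>k. csum (embed_scvx j A) (Q k) a) = csum (embed_scvx j A) (mix p Q) a"
      using csum_embed_scvx[of j A _ b, OF j Q] csum_embed_scvx[of j A p "\<lambda>k. csum A (Q k) b", OF j p]
        csum_embed_scvx[of j A _ b, OF j mix_in_GN[of p Q, OF p Q]] A_closed[of _ b] A_assoc[of p Q b] b p Q
      by simp
  qed (auto simp: embed_scvx_def)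
qed

text \<open>
  Transport along the embeddings: it reduces questions about the copies of \<open>N\<close> and \<open>\<Delta>\<^sub>\<nat>\<close> inside
  \<open>'v\<close> to the concrete spaces.
\<close>

lemma affine_between_embeddings:
  assumes j: "inj_on j (pts A)" and k: "inj_on k (pts B)" and A: "is_scvx A" and B: "is_scvx B"
    and f: "f \<in> countably_affine (embed_scvx j A) (embed_scvx k B)"
  obtains m where "m \<in> countably_affine A B" "\<And>x. x \<in> pts A \<Longrightarrow> f (j x) = k (m x)"
proof
  define m where "m = (\<lambda>x\<in>pts A. inv_into (pts B) k (f (j x)))"
  have f_pts: "f (j x) \<in> k ` pts B" if "x \<in> pts A" for x
    using f that unfolding countably_affine_def by auto
  show m: "f (j x) = k (m x)" if "x \<in> pts A" for x
    using f_pts[OF that] that by (simp add: m_def f_inv_into_f)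
  have m_pts: "m x \<in> pts B" if "x \<in> pts A" for x
    using f_pts[OF that] that by (simp add: m_def inv_into_into)
  show "m \<in> countably_affine A B"
    unfolding countably_affine_def
  proof (intro CollectI conjI ballI allI impI)
    show "m \<in> pts A \<rightarrow>\<^sub>E pts B" using m_pts by (auto simp: m_def)
    fix p and a :: "nat \<Rightarrow> _" assume p: "p \<in> GN" and "range a \<subseteq> pts A"
    then have a: "a i \<in> pts A" for i by auto
    have c: "csum A p a \<in> pts A"
      using A p a unfolding is_scvx_def by (simp add: image_subset_iff)
    have mem: "p \<in> GN \<Longrightarrow> range b \<subseteq> pts (embed_scvx j A) \<Longrightarrow>
        f (csum (embed_scvx j A) p b) = csum (embed_scvx k B) p (\<lambda>i. f (b i))" for b
      using f unfolding countably_affine_def by blast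
    have "k (m (csum A p a)) = f (csum (embed_scvx j A) p (\<lambda>i. j (a i)))"
      using csum_embed_scvx[OF j p a] m[OF c] by simp
    also have "\<dots> = csum (embed_scvx k B) p (\<lambda>i. k (m (a i)))"
      using mem[OF p, of "\<lambda>i. j (a i)"] a m by auto
    also have "\<dots> = k (csum B p (\<lambda>i. m (a i)))"
      using csum_embed_scvx[OF k p m_pts[OF a]] .
    finally have eq: "k (m (csum A p a)) = k (csum B p (\<lambda>i. m (a i)))" .
    show "m (csum A p a) = csum B p (\<lambda>i. m (a i))"
      using inj_onD[OF k eq m_pts[OF c]] B p m_pts[OF a] unfolding is_scvx_def
      by (simp add: image_subset_iff)
  qed
qed

section \<open>Countably affine maps are measurable\<close>

lemma N_meas_simps [simp]: "space N_meas = UNIV" "sets N_meas = UNIV" "emeasure N_meas = (\<lambda>_. 0)"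
  by (auto simp: N_meas_def emeasure_sigma space_measure_of_conv intro: in_measure_of)

lemma GN_meas_simps [simp]: "space GN_meas = GN" "emeasure GN_meas = (\<lambda>_. 0)"
  by (auto simp: GN_meas_def emeasure_sigma space_measure_of_conv)

lemma measurable_ev: "ev W \<in> borel_measurable GN_meas"
proof (rule measurableI)
  fix B :: "real set" assume "B \<in> sets borel"
  then show "ev W -` B \<inter> space GN_meas \<in> sets GN_meas"
    unfolding GN_meas_simps unfolding GN_meas_def by (intro in_measure_of) auto
qed simp

lemma measurable_into_GN_meas:
  assumes "f \<in> space M \<rightarrow> GN" and "\<And>W. (\<lambda>x. ev W (f x)) \<in> borel_measurable M"
  shows "f \<in> measurable M GN_meas"
  unfolding GN_meas_def
proof (rule measurable_measure_of)
  fix Y assume "Y \<in> {ev W -` B \<inter> GN | W B. B \<in> sets borel}"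
  then obtain W B where Y: "Y = ev W -` B \<inter> GN" "B \<in> sets borel" by blast
  then have "f -` Y \<inter> space M = (\<lambda>x. ev W (f x)) -` B \<inter> space M"
    using assms(1) by auto
  then show "f -` Y \<inter> space M \<in> sets M"
    using measurable_sets[OF assms(2) Y(2)] by simp
qed (use assms in auto)

lemma measurable_coefficient: "(\<lambda>p. p i) \<in> borel_measurable GN_meas"
proof -
  have "ev {i} = (\<lambda>p. p i)" by (rule ext) (simp add: ev_def)
  then show ?thesis using measurable_ev[of "{i}"] by simp
qed

text \<open>
  \<open>\<Delta>\<^sub>\<nat>\<close> is generated by the Dirac sequences, since \<open>p = \<Sum>\<^sub>i p\<^sub>i \<delta>\<^sub>i\<close>.
\<close>

lemma affine_on_Delta:
  assumes m: "m \<in> countably_affine Delta_scvx B" and p: "p \<in> GN"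
  shows "m p = csum B p (\<lambda>i. m (dirac i))"
proof -
  have d: "range dirac \<subseteq> pts Delta_scvx" using dirac_in_GN by auto
  then have "m (csum Delta_scvx p dirac) = csum B p (\<lambda>i. m (dirac i))"
    using m p unfolding countably_affine_def by blast
  moreover have "csum Delta_scvx p dirac = p"
    using Delta_scvx_simps(2)[OF p] d by (simp add: mix_dirac_right)
  ultimately show ?thesis by simp
qed

text \<open>
  Such a map sends \<open>p\<close> to the minimum of \<open>m \<delta>\<^sub>i\<close> over the support of \<open>p\<close>. Hence \<open>k \<le> m p\<close> is the
  countable conjunction of the conditions \<open>p\<^sub>i = 0\<close> for \<open>m \<delta>\<^sub>i < k\<close>.
\<close>

lemma affine_measurable_Delta_N:
  assumes m: "m \<in> countably_affine Delta_scvx N_scvx"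
  shows "m \<in> measurable GN_meas N_meas"
proof -
  have upper: "{p \<in> GN. k \<le> m p} \<in> sets GN_meas" for k
  proof -
    have "k \<le> m p \<longleftrightarrow> (\<forall>i\<in>{i. m (dirac i) < k}. p i = 0)" if p: "p \<in> GN" for p
    proof -
      have "m p = Inf {m (dirac i) | i. 0 < p i}"
        using affine_on_Delta[OF m p] p by simp
      moreover have "{m (dirac i) | i. 0 < p i} \<noteq> {}" using GN_support[OF p] by blast
      ultimately have "k \<le> m p \<longleftrightarrow> (\<forall>i. 0 < p i \<longrightarrow> k \<le> m (dirac i))"
        by (auto simp: le_cInf_iff)
      moreover have "0 < p i \<longleftrightarrow> p i \<noteq> 0" for i using GN_nonneg[OF p, of i] by auto
      ultimately show ?thesis by (metis (mono_tags, lifting) mem_Collect_eq not_le)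
    qed
    then have "{p \<in> GN. k \<le> m p} = {p \<in> space GN_meas. \<forall>i\<in>{i. m (dirac i) < k}. p i = 0}"
      by auto
    also have "\<dots> \<in> sets GN_meas"
      by (intro sets.sets_Collect_countable_Ball borel_measurable_eq measurable_coefficient
          borel_measurable_const)
    finally show ?thesis .
  qed
  have level: "m -` {k} \<inter> GN \<in> sets GN_meas" for k
  proof -
    have "m -` {k} \<inter> GN = {p \<in> GN. k \<le> m p} - {p \<in> GN. Suc k \<le> m p}" by auto
    then show ?thesis using upper by auto
  qed
  show ?thesis
  proof (rule measurableI)
    fix A assume "A \<in> sets N_meas"
    have "m -` A \<inter> GN = (\<Union>k\<in>A. m -` {k} \<inter> GN)" by auto
    also have "\<dots> \<in> sets GN_meas" using level by (intro sets.countable_UN') auto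
    finally show "m -` A \<inter> space GN_meas \<in> sets GN_meas" by simp
  qed simp
qed

text \<open>
  Here \<open>ev W (m p) = \<Sum>\<^sub>i p\<^sub>i ev W (m \<delta>\<^sub>i)\<close>, a series of measurable functions of \<open>p\<close>.
\<close>

lemma affine_measurable_Delta_Delta:
  assumes m: "m \<in> countably_affine Delta_scvx Delta_scvx"
  shows "m \<in> measurable GN_meas GN_meas"
proof (rule measurable_into_GN_meas)
  have m_GN: "m p \<in> GN" if "p \<in> GN" for p
    using m that unfolding countably_affine_def by auto
  then show "m \<in> space GN_meas \<rightarrow> GN" by auto
  fix W
  have "ev W (m p) = (\<Sum>i. p i * ev W (m (dirac i)))" if p: "p \<in> GN" for p
  proof -
    have d: "m (dirac i) \<in> GN" for i using m_GN dirac_in_GN by blast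
    then have "m p = mix p (\<lambda>i. m (dirac i))"
      using affine_on_Delta[OF m p] p by (simp add: image_subset_iff)
    then show ?thesis using ev_mix[OF p d] by simp
  qed
  moreover have "(\<lambda>p. \<Sum>i. p i * ev W (m (dirac i))) \<in> borel_measurable GN_meas"
    using measurable_coefficient by (intro borel_measurable_suminf borel_measurable_times) auto
  ultimately show "(\<lambda>p. ev W (m p)) \<in> borel_measurable GN_meas"
    by (subst measurable_cong[where g = "\<lambda>p. \<Sum>i. p i * ev W (m (dirac i))"]) auto
qed

lemma affine_measurable_from_N:
  assumes "m \<in> countably_affine N_scvx B" and "pts B = space X"
  shows "m \<in> measurable N_meas X"
  using assms by (intro measurableI) (auto simp: countably_affine_def)

lemma measurable_between_embeddings:
  assumes j: "inj_on j (pts A)" and k: "inj_on k (pts B)" and A: "is_scvx A" and B: "is_scvx B"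
    and X: "space X = pts A" and Y: "space Y = pts B"
    and meas: "\<And>m. m \<in> countably_affine A B \<Longrightarrow> m \<in> measurable X Y"
    and f: "f \<in> countably_affine (embed_scvx j A) (embed_scvx k B)"
  shows "f \<in> measurable (embed_measure X j) (embed_measure Y k)"
proof -
  obtain m where m: "m \<in> countably_affine A B" "\<And>x. x \<in> pts A \<Longrightarrow> f (j x) = k (m x)"
    using affine_between_embeddings[OF j k A B f] by blast
  have "(\<lambda>x. k (m x)) \<in> measurable X (embed_measure Y k)"
    using measurable_compose[OF meas[OF m(1)] measurable_embed_measure2'] k Y by simp
  then have "(\<lambda>x. f (j x)) \<in> measurable X (embed_measure Y k)"
    using m(2) X by (subst measurable_cong[where g = "\<lambda>x. k (m x)"]) auto
  then show ?thesis by (rule measurable_embed_measure1)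
qed

lemma embed_measure_zero:
  assumes "emeasure M = (\<lambda>_. 0)"
  shows "emeasure (embed_measure M f) = (\<lambda>_. 0)"
  using assms by (simp add: embed_measure_def emeasure_sigma)

section \<open>The two categories, and distinctness of the two objects\<close>

lemma Meas_simps [simp]:
  "X \<in> Ob (Meas \<V>) \<longleftrightarrow> space X \<in> \<V> \<and> emeasure X = (\<lambda>_. 0)"
  "Hom (Meas \<V>) X Y = measurable X Y \<inter> extensional (space X)"
  "Comp (Meas \<V>) X Y Z g f = compose (space X) g f"
  "Id (Meas \<V>) X = (\<lambda>x\<in>space X. x)"
  by (simp_all add: Meas_def)

lemma SCvx_simps [simp]:
  "A \<in> Ob (SCvx \<U>) \<longleftrightarrow> is_scvx A \<and> pts A \<in> \<U>"
  "Hom (SCvx \<U>) = countably_affine"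
  "Comp (SCvx \<U>) A B C g f = compose (pts A) g f"
  "Id (SCvx \<U>) A = (\<lambda>x\<in>pts A. x)"
  by (simp_all add: SCvx_def)

lemma category_SCvx: "is_category (SCvx (\<U> :: 'v set set))"
proof -
  have comp: "compose (pts A) g f \<in> countably_affine A C"
    if A: "is_scvx A" and f: "f \<in> countably_affine A B" and g: "g \<in> countably_affine B C" for A B C :: "'v scvx" and f g :: "'v \<Rightarrow> 'v"
  proof -
    have fA: "f x \<in> pts B" if "x \<in> pts A" for x using f that by (auto simp: countably_affine_def)
    have gB: "g x \<in> pts C" if "x \<in> pts B" for x using g that by (auto simp: countably_affine_def)
    have "g (f (csum A p a)) = csum C p (\<lambda>i. g (f (a i)))" if "p \<in> GN" "range a \<subseteq> pts A" for p a
    proof -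
      have "range (\<lambda>i. f (a i)) \<subseteq> pts B" using that fA by auto
      then show ?thesis using f g that by (simp add: countably_affine_def)
    qed
    moreover have "csum A p a \<in> pts A" if "p \<in> GN" "range a \<subseteq> pts A" for p a
      using A that unfolding is_scvx_def by blast
    ultimately show ?thesis
      using fA gB by (auto simp: countably_affine_def compose_def image_subset_iff)
  qed
  have ident: "(\<lambda>x\<in>pts A. x) \<in> countably_affine A A" if A: "is_scvx A" for A :: "'v scvx"
    using A by (auto simp: countably_affine_def is_scvx_def image_subset_iff)
  have unit: "compose (pts A) f (\<lambda>x\<in>pts A. x) = f \<and> compose (pts A) (\<lambda>x\<in>pts B. x) f = f"
    if "f \<in> countably_affine A B" for A B :: "'v scvx" and f :: "'v \<Rightarrow> 'v"
    using that by (auto simp: countably_affine_def compose_def extensional_def fun_eq_iff PiE_iff)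
  have assoc: "compose (pts A) h (compose (pts A) g f) = compose (pts A) (compose (pts B) h g) f"
    if "f \<in> countably_affine A B" for A B :: "'v scvx" and f g h :: "'v \<Rightarrow> 'v"
    using that by (intro compose_assoc) (auto simp: countably_affine_def)
  show ?thesis
    unfolding is_category_def SCvx_simps
  proof (intro conjI ballI)
    fix A assume "A \<in> Ob (SCvx \<U>)"
    then have A: "is_scvx A" by simp
    show "(\<lambda>x\<in>pts A. x) \<in> countably_affine A A" by (rule ident[OF A])
    fix B :: "'v scvx" and f assume f: "f \<in> countably_affine A B"
    show "compose (pts A) f (\<lambda>x\<in>pts A. x) = f" "compose (pts A) (\<lambda>x\<in>pts B. x) f = f"
      using unit[OF f] by auto
    fix C :: "'v scvx" and g assume g: "g \<in> countably_affine B C"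
    show "compose (pts A) g f \<in> countably_affine A C" by (rule comp[OF A f g])
    show "compose (pts A) h (compose (pts A) g f) = compose (pts A) (compose (pts B) h g) f"
      for h :: "'v \<Rightarrow> 'v"
      by (rule assoc[OF f])
  qed
qed

lemma category_Meas: "is_category (Meas (\<V> :: 'v set set))"
proof -
  have comp: "compose (space X) g f \<in> measurable X Z \<inter> extensional (space X)"
    if "f \<in> measurable X Y" and "g \<in> measurable Y Z" for X Y Z :: "'v measure" and f g :: "'v \<Rightarrow> 'v"
    using measurable_compose[OF that] by (simp add: compose_def cong: measurable_cong)
  have ident: "(\<lambda>x\<in>space X. x) \<in> measurable X X" for X :: "'v measure"
    by (simp cong: measurable_cong)
  have unit: "compose (space X) f (\<lambda>x\<in>space X. x) = f \<and> compose (space X) (\<lambda>x\<in>space Y. x) f = f"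
    if "f \<in> measurable X Y" "f \<in> extensional (space X)" for X Y :: "'v measure" and f :: "'v \<Rightarrow> 'v"
    using that(2) measurable_space[OF that(1)] by (auto simp: compose_def extensional_def fun_eq_iff)
  have assoc: "compose (space X) h (compose (space X) g f) = compose (space X) (compose (space Y) h g) f"
    if "f \<in> measurable X Y" for X Y :: "'v measure" and f g h :: "'v \<Rightarrow> 'v"
    using measurable_space[OF that] by (intro compose_assoc) auto
  show ?thesis
    unfolding is_category_def Meas_simps
  proof (intro conjI ballI)
    show "(\<lambda>x\<in>space X. x) \<in> measurable X X \<inter> extensional (space X)" for X :: "'v measure"
      using ident by simp
    fix X Y :: "'v measure" and f assume f: "f \<in> measurable X Y \<inter> extensional (space X)"
    show "compose (space X) f (\<lambda>x\<in>space X. x) = f" "compose (space X) (\<lambda>x\<in>space Y. x) f = f"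
      using unit[of f X Y] f by auto
    fix Z :: "'v measure" and g assume g: "g \<in> measurable Y Z \<inter> extensional (space Y)"
    show "compose (space X) g f \<in> measurable X Z \<inter> extensional (space X)"
      using comp[of f X Y g Z] f g by blast
    show "compose (space X) h (compose (space X) g f) = compose (space X) (compose (space Y) h g) f"
      for h :: "'v \<Rightarrow> 'v"
      using assoc[of f X Y h g] f by blast
  qed
qed

text \<open>
  The underlying sets differ in cardinality, but it is quicker to compare the structures: a minimum is
  one of the values, whereas the even mixture of two different Dirac sequences is not a Dirac sequence.
\<close>

lemma N_obj_neq_Delta_obj:
  assumes jN: "inj jN" and jD: "inj_on jD GN"
  shows "N_obj jN \<noteq> Delta_obj jD"
proof
  assume eq: "N_obj jN = Delta_obj jD"
  \<comment> \<open>The even mixture of \<open>dirac 0\<close> and \<open>dirac 1\<close>.\<close>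
  define p :: "nat \<Rightarrow> real" where "p = (\<lambda>i. if i \<in> {0, 1} then 1/2 else 0)"
  have "p sums (\<Sum>i\<in>{0, 1}. p i)"
    by (rule sums_finite) (auto simp: p_def)
  then have p: "p \<in> GN" by (auto simp: GN_def p_def)
  have "jD ` GN = range jN"
    using arg_cong[OF eq, of pts] by (simp add: N_obj_def Delta_obj_def)
  then have "range (\<lambda>i. jD (dirac i)) \<subseteq> range jN"
    using dirac_in_GN by blast
  then obtain u where u: "\<And>i. jD (dirac i) = jN (u i)"
    using family_in_image[of "\<lambda>i. jD (dirac i)" jN UNIV] by metis
  have "jD p = csum (Delta_obj jD) p (\<lambda>i. jD (dirac i))"
    using csum_embed_scvx[of jD Delta_scvx p dirac] jD p dirac_in_GN
    by (simp add: Delta_obj_def image_subset_iff mix_dirac_right)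
  also have "\<dots> = csum (N_obj jN) p (\<lambda>i. jN (u i))"
    using eq u by simp
  also have "\<dots> = jN (Inf {u i | i. 0 < p i})"
    using csum_embed_scvx[of jN N_scvx p u] jN p by (simp add: N_obj_def)
  also have "\<exists>i. Inf {u i | i. 0 < p i} = u i"
    using Inf_nat_def1[of "{u i | i. 0 < p i}"] GN_support[OF p] by blast
  then obtain i where "Inf {u i | i. 0 < p i} = u i" by blast
  finally have "jD p = jD (dirac i)" using u by simp
  then have "p = dirac i" using inj_onD[OF jD] p dirac_in_GN by blast
  then have "p i = 1" by (simp add: dirac_def)
  then show False by (simp add: p_def split: if_splits)
qed

section \<open>Limits of measurable spaces\<close>

text \<open>
  The points of the limit of the underlying sets over \<open>c \<down> S\<close>: families of points \<open>\<phi> (t, f)\<close> of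
  \<open>T t\<close>, indexed by the arrows \<open>f : c \<rightarrow> t\<close>, that the arrows between the objects of \<open>S\<close> preserve.
\<close>

definition compatible_families ::
  "('o, 'm) category \<Rightarrow> 'o set \<Rightarrow> ('o, 'm, 'v measure, 'v \<Rightarrow> 'v) functor_data \<Rightarrow> 'o \<Rightarrow> ('o \<times> 'm \<Rightarrow> 'v) set" where
  "compatible_families C S T c =
     {\<phi> \<in> extensional (SIGMA t:S. Hom C c t).
        (\<forall>t\<in>S. \<forall>f\<in>Hom C c t. \<phi> (t, f) \<in> space (FOb T t)) \<and>
        (\<forall>t\<in>S. \<forall>t'\<in>S. \<forall>f\<in>Hom C c t. \<forall>h\<in>Hom C t t'.
           FHom T t t' h (\<phi> (t, f)) = \<phi> (t', Comp C c t t' h f))}"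

text \<open>
  A limit in measurable spaces is the limit of the underlying sets with the smallest
  \<open>\<sigma>\<close>-algebra that makes all projections measurable. The set \<open>B\<close> only supplies names in \<open>'v\<close> for the
  families: the limit lives on the image of the families under an injection into \<open>B\<close>.
\<close>

lemma limit_cone_in_Meas:
  assumes C: "is_category C" and S: "S \<subseteq> Ob C" and c: "c \<in> Ob C"
    and V: "\<And>A. A \<subseteq> B \<Longrightarrow> A \<in> \<V>"
    and small: "compatible_families C S T c \<lesssim> B"
  shows "\<exists>L \<pi>. is_limit_cone C S (Meas \<V>) T c L \<pi>"
proof -
  let ?\<Phi> = "compatible_families C S T c"
  let ?I = "SIGMA t:S. Hom C c t"
  obtain e where e: "inj_on e ?\<Phi>" "e ` ?\<Phi> \<subseteq> B"
    using small unfolding lepoll_def by blast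
  define \<pi> where "\<pi> t f = (\<lambda>x\<in>e ` ?\<Phi>. inv_into ?\<Phi> e x (t, f))" for t f
  define G where "G = {\<pi> t f -` A \<inter> e ` ?\<Phi> | t f A. t \<in> S \<and> f \<in> Hom C c t \<and> A \<in> sets (FOb T t)}"
  define L where "L = sigma (e ` ?\<Phi>) G"
  have G: "G \<subseteq> Pow (e ` ?\<Phi>)" unfolding G_def by blast
  have space_L: "space L = e ` ?\<Phi>" and emeasure_L: "emeasure L = (\<lambda>_. 0)"
    using G by (simp_all add: L_def space_measure_of_conv emeasure_sigma)
  have \<pi>_e [simp]: "\<pi> t f (e \<phi>) = \<phi> (t, f)" if "\<phi> \<in> ?\<Phi>" for t f \<phi>
    using that e by (simp add: \<pi>_def inv_into_f_f)
  have in_space: "\<phi> (t, f) \<in> space (FOb T t)" if "\<phi> \<in> ?\<Phi>" "t \<in> S" "f \<in> Hom C c t" for \<phi> t f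
    using that unfolding compatible_families_def by blast
  have compat: "FHom T t t' h (\<phi> (t, f)) = \<phi> (t', Comp C c t t' h f)"
    if "\<phi> \<in> ?\<Phi>" "t \<in> S" "t' \<in> S" "f \<in> Hom C c t" "h \<in> Hom C t t'" for \<phi> t t' f h
    using that unfolding compatible_families_def by blast
  have "is_limit_cone C S (Meas \<V>) T c L \<pi>"
    unfolding is_limit_cone_def
  proof (intro conjI ballI allI impI)
    show "L \<in> Ob (Meas \<V>)" using V[OF e(2)] by (simp add: space_L emeasure_L)
    show "is_cone C S (Meas \<V>) T c L \<pi>"
      unfolding is_cone_def
    proof (intro conjI ballI)
      fix t f assume t: "t \<in> S" and f: "f \<in> Hom C c t"
      have "\<pi> t f \<in> measurable L (FOb T t)"
      proof (rule measurableI)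
        show "\<pi> t f x \<in> space (FOb T t)" if "x \<in> space L" for x
          using that in_space t f by (auto simp: space_L)
        fix A assume "A \<in> sets (FOb T t)"
        then have "\<pi> t f -` A \<inter> e ` ?\<Phi> \<in> G" using t f unfolding G_def by blast
        then show "\<pi> t f -` A \<inter> space L \<in> sets L"
          unfolding space_L using G by (simp add: L_def in_measure_of)
      qed
      then show "\<pi> t f \<in> Hom (Meas \<V>) L (FOb T t)" by (simp add: space_L \<pi>_def)
    next
      fix t t' f h assume t: "t \<in> S" "t' \<in> S" and f: "f \<in> Hom C c t" and h: "h \<in> Hom C t t'"
      have "compose (e ` ?\<Phi>) (FHom T t t' h) (\<pi> t f) x = \<pi> t' (Comp C c t t' h f) x" for x
      proof (cases "x \<in> e ` ?\<Phi>")
        case True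
        then obtain \<phi> where "\<phi> \<in> ?\<Phi>" "x = e \<phi>" by blast
        then show ?thesis using compat[OF _ t f h] True by (simp add: compose_def)
      qed (simp add: compose_def \<pi>_def)
      then show "Comp (Meas \<V>) L (FOb T t) (FOb T t') (FHom T t t' h) (\<pi> t f) = \<pi> t' (Comp C c t t' h f)"
        by (simp add: space_L fun_eq_iff)
    qed
  next
    fix X \<kappa> assume X: "X \<in> Ob (Meas \<V>)" and cone: "is_cone C S (Meas \<V>) T c X \<kappa>"
    have \<kappa>: "\<kappa> t f \<in> measurable X (FOb T t)" "\<kappa> t f \<in> extensional (space X)"
      if "t \<in> S" "f \<in> Hom C c t" for t f
      using cone that unfolding is_cone_def by auto
    define \<phi> where "\<phi> x = (\<lambda>(t, f)\<in>?I. \<kappa> t f x)" for x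
    have \<phi>_apply: "\<phi> x (t, f) = \<kappa> t f x" if "t \<in> S" "f \<in> Hom C c t" for t f x
      using that by (simp add: \<phi>_def)
    have \<phi>_family: "\<phi> x \<in> ?\<Phi>" if x: "x \<in> space X" for x
      unfolding compatible_families_def
    proof (intro CollectI conjI ballI)
      show "\<phi> x \<in> extensional ?I" by (simp add: \<phi>_def)
      show "\<phi> x (t, f) \<in> space (FOb T t)" if "t \<in> S" "f \<in> Hom C c t" for t f
        using measurable_space[OF \<kappa>(1)[OF that] x] \<phi>_apply[OF that] by simp
      fix t t' f h assume t: "t \<in> S" "t' \<in> S" and f: "f \<in> Hom C c t" and h: "h \<in> Hom C t t'"
      have hf: "Comp C c t t' h f \<in> Hom C c t'"
        using category_comp[OF C c _ _ f h] S t by blast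
      have "compose (space X) (FHom T t t' h) (\<kappa> t f) = \<kappa> t' (Comp C c t t' h f)"
        using cone t f h unfolding is_cone_def by simp
      from fun_cong[OF this, of x] show "FHom T t t' h (\<phi> x (t, f)) = \<phi> x (t', Comp C c t t' h f)"
        using x \<phi>_apply[OF t(1) f] \<phi>_apply[OF t(2) hf] by (simp add: compose_def)
    qed
    define u where "u = (\<lambda>x\<in>space X. e (\<phi> x))"
    have "u \<in> measurable X (sigma (e ` ?\<Phi>) G)"
    proof (rule measurable_measure_of[OF G])
      show "u \<in> space X \<rightarrow> e ` ?\<Phi>" using \<phi>_family by (auto simp: u_def)
      fix Y assume "Y \<in> G"
      then obtain t f A where Y: "Y = \<pi> t f -` A \<inter> e ` ?\<Phi>"
        and t: "t \<in> S" and f: "f \<in> Hom C c t" and A: "A \<in> sets (FOb T t)"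
        unfolding G_def by blast
      have "u -` Y \<inter> space X = \<kappa> t f -` A \<inter> space X"
        using \<phi>_family \<phi>_apply[OF t f] by (auto simp: Y u_def)
      then show "u -` Y \<inter> space X \<in> sets X"
        using measurable_sets[OF \<kappa>(1)[OF t f] A] by simp
    qed
    then have u_meas: "u \<in> measurable X L" by (simp add: L_def)
    show "\<exists>!u. u \<in> Hom (Meas \<V>) X L \<and>
        (\<forall>t\<in>S. \<forall>f\<in>Hom C c t. Comp (Meas \<V>) X L (FOb T t) (\<pi> t f) u = \<kappa> t f)"
    proof (rule ex1I, intro conjI ballI)
      show "u \<in> Hom (Meas \<V>) X L" using u_meas by (simp add: u_def)
      fix t f assume t: "t \<in> S" and f: "f \<in> Hom C c t"
      have "compose (space X) (\<pi> t f) u x = \<kappa> t f x" for x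
        using \<phi>_family \<phi>_apply[OF t f] \<kappa>(2)[OF t f]
        by (cases "x \<in> space X") (simp_all add: compose_def u_def extensional_def)
      then show "Comp (Meas \<V>) X L (FOb T t) (\<pi> t f) u = \<kappa> t f" by (simp add: fun_eq_iff)
    next
      fix v assume "v \<in> Hom (Meas \<V>) X L \<and>
        (\<forall>t\<in>S. \<forall>f\<in>Hom C c t. Comp (Meas \<V>) X L (FOb T t) (\<pi> t f) v = \<kappa> t f)"
      then have v: "v \<in> measurable X L" "v \<in> extensional (space X)"
        and v\<kappa>: "\<And>t f. \<lbrakk>t \<in> S; f \<in> Hom C c t\<rbrakk> \<Longrightarrow> compose (space X) (\<pi> t f) v = \<kappa> t f" by auto
      show "v = u"
      proof (rule extensionalityI[OF v(2)])
        show "u \<in> extensional (space X)" by (simp add: u_def)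
        fix x assume x: "x \<in> space X"
        obtain \<psi> where \<psi>: "\<psi> \<in> ?\<Phi>" "v x = e \<psi>"
          using measurable_space[OF v(1) x] by (auto simp: space_L)
        have "\<psi> i = \<phi> x i" if iI: "i \<in> ?I" for i
        proof -
          obtain t f where i: "i = (t, f)" and t: "t \<in> S" and f: "f \<in> Hom C c t"
            using iI by blast
          from fun_cong[OF v\<kappa>[OF t f], of x] show ?thesis
            using x \<psi> \<phi>_apply[OF t f] by (simp add: compose_def i)
        qed
        moreover have "\<psi> \<in> extensional ?I" "\<phi> x \<in> extensional ?I"
          using \<psi>(1) \<phi>_family[OF x] unfolding compatible_families_def by auto
        ultimately have "\<psi> = \<phi> x" by (intro extensionalityI[where A = ?I])
        then show "v x = u x" using x \<psi> by (simp add: u_def)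
      qed
    qed
  qed
  then show ?thesis by blast
qed

section \<open>Size of the limits\<close>

lemma lepoll_Pow_mono:
  assumes "A \<lesssim> B" shows "Pow A \<lesssim> Pow B"
proof -
  obtain f where f: "inj_on f A" "f ` A \<subseteq> B" using assms unfolding lepoll_def by blast
  then have "inj_on (image f) (Pow A)" by (intro inj_on_image) (simp add: f)
  then show ?thesis unfolding lepoll_def using f(2) by blast
qed

text \<open>
  The natural number \<open>k\<close> is stored next to a subset of \<open>A \<times> \<nat>\<close> by moving that subset to the even
  indices and adding the pair \<open>(a, 2k + 1)\<close> for a fixed \<open>a \<in> A\<close>.
\<close>

lemma nat_times_Pow_lepoll:
  assumes "A \<noteq> {}"
  shows "(UNIV :: nat set) \<times> Pow (A \<times> (UNIV :: nat set)) \<lesssim> Pow (A \<times> (UNIV :: nat set))"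
proof -
  obtain a where a: "a \<in> A" using assms by blast
  define code where "code = (\<lambda>(k, X). insert (a, Suc (2 * k)) {(x, 2 * n) | x n. (x, n) \<in> X})"
  have k_eq: "k = k'" if "code (k, X) = code (k', X')" for k k' and X X' :: "('a \<times> nat) set"
  proof -
    have "(a, Suc (2 * k)) \<in> code (k', X')" using that[symmetric] by (simp add: code_def)
    then have "Suc (2 * k) = Suc (2 * k') \<or> (\<exists>n. Suc (2 * k) = 2 * n)" by (auto simp: code_def)
    then show ?thesis by presburger
  qed
  have mem_X: "(x, n) \<in> X \<longleftrightarrow> (x, 2 * n) \<in> code (k, X)" for x n k and X :: "('a \<times> nat) set"
  proof -
    have "2 * n \<noteq> Suc (2 * k)" by presburger
    then show ?thesis by (auto simp: code_def)
  qed
  have "inj_on code (UNIV \<times> Pow (A \<times> UNIV))"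
  proof (rule inj_onI, clarify)
    fix k k' and X X' :: "('a \<times> nat) set" assume eq: "code (k, X) = code (k', X')"
    have "z \<in> X \<longleftrightarrow> z \<in> X'" for z
      using mem_X[of "fst z" "snd z" X k] mem_X[of "fst z" "snd z" X' k'] eq by simp
    then show "k = k' \<and> X = X'" using k_eq[OF eq] by blast
  qed
  moreover have "code ` (UNIV \<times> Pow (A \<times> UNIV)) \<subseteq> Pow (A \<times> UNIV)"
    using a by (auto simp: code_def)
  ultimately show ?thesis unfolding lepoll_def by blast
qed

text \<open>
  A sequence of reals is determined by the rationals below each of its entries.
\<close>

lemma sequences_lepoll_sets: "(UNIV :: (nat \<Rightarrow> real) set) \<lesssim> (UNIV :: nat set set)"
proof -
  define code where "code p = to_nat ` {(i, q :: rat). of_rat q < p i}" for p :: "nat \<Rightarrow> real"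
  have "inj code"
  proof (rule injI)
    fix p r assume "code p = code r"
    then have "{(i, q :: rat). of_rat q < p i} = {(i, q). of_rat q < r i}"
      unfolding code_def by (simp add: inj_image_eq_iff)
    then have "of_rat q < p i \<longleftrightarrow> of_rat q < r i" for i and q :: rat by blast
    then show "p = r"
      using of_rat_dense by (metis ext less_irrefl linorder_neqE_linordered_idom order_less_trans)
  qed
  then show ?thesis unfolding lepoll_def by blast
qed

text \<open>
  If all fibres have at most the size of the continuum, a map \<open>f\<close> on \<open>A\<close> is a subset of \<open>A \<times> \<nat>\<close>.
  As \<open>S\<close> is countable and \<open>A\<close> nonempty, there are at most \<open>2\<^bsup>A\<times>\<nat>\<^esup>\<close> pairs \<open>(t, f)\<close>; by the
  same encoding, a family indexed by these pairs is a set of subsets of \<open>A \<times> \<nat>\<close>.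
\<close>

lemma families_lepoll:
  fixes S :: "'o set" and A :: "'a set" and Z :: "'o \<Rightarrow> 'z set" and W :: "'o \<Rightarrow> 'w set"
  assumes S: "countable S" and A: "A \<noteq> {}"
    and F: "\<And>t. t \<in> S \<Longrightarrow> F t \<subseteq> A \<rightarrow>\<^sub>E Z t"
    and Z: "\<And>t. t \<in> S \<Longrightarrow> Z t \<lesssim> (UNIV :: nat set set)"
    and W: "\<And>t. t \<in> S \<Longrightarrow> W t \<lesssim> (UNIV :: nat set set)"
  shows "(\<Pi>\<^sub>E (t, f)\<in>(SIGMA t:S. F t). W t) \<lesssim> Pow (Pow (A \<times> (UNIV :: nat set)))"
proof -
  let ?I = "SIGMA t:S. F t"
  let ?P = "Pow (A \<times> (UNIV :: nat set))"
  define c :: "'o \<Rightarrow> 'z \<Rightarrow> nat set" where "c t = (SOME f. inj_on f (Z t))" for t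
  have c: "inj_on (c t) (Z t)" if "t \<in> S" for t
  proof -
    have "\<exists>f :: 'z \<Rightarrow> nat set. inj_on f (Z t)" using Z[OF that] unfolding lepoll_def by blast
    then show ?thesis unfolding c_def by (rule someI_ex)
  qed
  define d :: "'o \<Rightarrow> 'w \<Rightarrow> nat set" where "d t = (SOME f. inj_on f (W t))" for t
  have d: "inj_on (d t) (W t)" if "t \<in> S" for t
  proof -
    have "\<exists>f :: 'w \<Rightarrow> nat set. inj_on f (W t)" using W[OF that] unfolding lepoll_def by blast
    then show ?thesis unfolding d_def by (rule someI_ex)
  qed
  define graph where "graph = (\<lambda>(t, f). (to_nat_on S t, {(a, n). a \<in> A \<and> n \<in> (c t (f a) :: nat set)}))"
  have "inj_on graph ?I"
  proof (rule inj_onI, clarify)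
    fix t f t' f' assume t: "t \<in> S" and f: "f \<in> F t" and t': "t' \<in> S" and f': "f' \<in> F t'"
      and eq: "graph (t, f) = graph (t', f')"
    then have tt: "t' = t" using inj_on_to_nat_on[OF S] by (auto simp: graph_def inj_on_def)
    have fZ: "f \<in> A \<rightarrow>\<^sub>E Z t" "f' \<in> A \<rightarrow>\<^sub>E Z t" using F t f f' tt by blast+
    have "f a = f' a" if a: "a \<in> A" for a
    proof -
      have "n \<in> c t (f a) \<longleftrightarrow> n \<in> c t (f' a)" for n
        using eq a tt by (auto simp: graph_def set_eq_iff)
      then have "c t (f a) = c t (f' a)" by blast
      then show ?thesis using inj_onD[OF c[OF t]] fZ a by blast
    qed
    then have "f = f'" using fZ by (intro PiE_ext)
    then show "t = t' \<and> f = f'" using tt by simp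
  qed
  moreover have "graph ` ?I \<subseteq> UNIV \<times> ?P" by (auto simp: graph_def)
  ultimately have "?I \<lesssim> (UNIV :: nat set) \<times> ?P" unfolding lepoll_def by blast
  then have I: "?I \<lesssim> ?P" using nat_times_Pow_lepoll[OF A] by (rule lepoll_trans)
  have "?I \<times> (UNIV :: nat set) \<lesssim> ?P \<times> (UNIV :: nat set)"
    using I by (intro times_lepoll_mono) auto
  also have "\<dots> \<approx> (UNIV :: nat set) \<times> ?P" by (rule times_commute_eqpoll)
  also have "\<dots> \<lesssim> ?P" by (rule nat_times_Pow_lepoll[OF A])
  finally have IN: "Pow (?I \<times> (UNIV :: nat set)) \<lesssim> Pow ?P" by (rule lepoll_Pow_mono)
  define total where "total \<phi> = {(i, n). i \<in> ?I \<and> n \<in> (d (fst i) (\<phi> i) :: nat set)}" for \<phi>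
  have "inj_on total (\<Pi>\<^sub>E (t, f)\<in>?I. W t)"
  proof (rule inj_onI)
    fix \<phi> \<psi> assume \<phi>: "\<phi> \<in> (\<Pi>\<^sub>E (t, f)\<in>?I. W t)" and \<psi>: "\<psi> \<in> (\<Pi>\<^sub>E (t, f)\<in>?I. W t)"
      and eq: "total \<phi> = total \<psi>"
    show "\<phi> = \<psi>"
    proof (rule PiE_ext[OF \<phi> \<psi>])
      fix i assume i: "i \<in> ?I"
      have "n \<in> d (fst i) (\<phi> i) \<longleftrightarrow> n \<in> d (fst i) (\<psi> i)" for n
      proof -
        have "(i, n) \<in> total \<phi> \<longleftrightarrow> (i, n) \<in> total \<psi>" using eq by simp
        then show ?thesis unfolding total_def using i by blast
      qed
      then have "d (fst i) (\<phi> i) = d (fst i) (\<psi> i)" by blast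
      moreover have "fst i \<in> S" "\<phi> i \<in> W (fst i)" "\<psi> i \<in> W (fst i)"
        using i PiE_mem[OF \<phi> i] PiE_mem[OF \<psi> i] by (auto split: prod.splits)
      ultimately show "\<phi> i = \<psi> i" using inj_onD[OF d] by blast
    qed
  qed
  moreover have "total ` (\<Pi>\<^sub>E (t, f)\<in>?I. W t) \<subseteq> Pow (?I \<times> UNIV)" unfolding total_def by blast
  ultimately have "(\<Pi>\<^sub>E (t, f)\<in>?I. W t) \<lesssim> Pow (?I \<times> (UNIV :: nat set))"
    unfolding lepoll_def by blast
  then show ?thesis using IN by (rule lepoll_trans)
qed

text \<open>
  There is exactly one map \<open>f\<close> from the empty space to \<open>N\<close>, and every endomap of \<open>N\<close> leaves it fixed. The
  component at \<open>f\<close> of a compatible family is therefore a common fixed point of all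
  endomaps of \<open>N\<close>. Constant maps are countably affine, so that no such point exists.
\<close>

lemma no_compatible_families_on_empty:
  assumes jN: "inj jN" and N: "N_obj jN \<in> S" and c: "pts c = {}"
    and T: "space (FOb T (N_obj jN)) = range jN" "\<And>h. FHom T (N_obj jN) (N_obj jN) h = h"
  shows "compatible_families (SCvx \<U>) S T c = {}"
proof (rule ccontr)
  assume "compatible_families (SCvx \<U>) S T c \<noteq> {}"
  then obtain \<phi> where \<phi>: "\<phi> \<in> compatible_families (SCvx \<U>) S T c" by blast
  let ?N = "N_obj jN"
  let ?f = "\<lambda>_. undefined"
  have f: "?f \<in> countably_affine c ?N"
    using c by (simp add: countably_affine_def)
  define const where "const n = (\<lambda>x\<in>range jN. jN n)" for n
  have const: "const n \<in> countably_affine ?N ?N" for n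
    unfolding countably_affine_def
  proof (intro CollectI conjI ballI allI impI)
    show "const n \<in> pts ?N \<rightarrow>\<^sub>E pts ?N" by (auto simp: const_def N_obj_def)
    fix p and a :: "nat \<Rightarrow> _" assume p: "p \<in> GN" and "range a \<subseteq> pts ?N"
    then have "range a \<subseteq> jN ` UNIV" by (simp add: N_obj_def)
    then obtain u where u: "a = (\<lambda>i. jN (u i))" using family_in_image by blast
    have "{n | i. 0 < p i} = {n}" using GN_support[OF p] by blast
    then have "csum N_scvx p (\<lambda>i. n) = n" using p by simp
    then show "const n (csum ?N p a) = csum ?N p (\<lambda>i. const n (a i))"
      using csum_embed_scvx[of jN N_scvx p u] csum_embed_scvx[of jN N_scvx p "\<lambda>_. n"] jN p
      by (simp add: u const_def N_obj_def)
  qed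
  have "\<phi> (?N, ?f) = jN n" for n
  proof -
    have "compose (pts c) (const n) ?f = ?f" using c by (auto simp: compose_def)
    moreover have "FHom T ?N ?N (const n) (\<phi> (?N, ?f)) = \<phi> (?N, compose (pts c) (const n) ?f)"
      using \<phi> N f const[of n] unfolding compatible_families_def SCvx_simps by blast
    ultimately have "const n (\<phi> (?N, ?f)) = \<phi> (?N, ?f)"
      using T(2) by simp
    moreover have "\<phi> (?N, ?f) \<in> range jN"
      using \<phi> N f T(1) unfolding compatible_families_def by auto
    ultimately show ?thesis by (simp add: const_def)
  qed
  then have "jN 0 = jN 1" by metis
  then show False using jN by (simp add: inj_eq)
qed

section \<open>The Kan extension along \<open>\<Omega>\<close>\<close>

lemma Sigma_functor_into_Meas:
  assumes U: "universes \<U> \<V>"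
    and jN: "inj jN" "range jN \<in> \<U>" and jD: "inj_on jD GN" "jD ` GN \<in> \<U>"
  shows "is_functor (Omega \<U> jN jD) (Meas \<V>) (Sigma_functor jN jD)"
    and "{N_obj jN, Delta_obj jD} \<subseteq> Ob (SCvx \<U>)"
    and "t \<in> {N_obj jN, Delta_obj jD} \<Longrightarrow> space (FOb (Sigma_functor jN jD) t) = pts t"
proof -
  let ?N = "N_obj jN" and ?D = "Delta_obj jD" and ?F = "Sigma_functor jN jD"
  have ne: "?D \<noteq> ?N" using N_obj_neq_Delta_obj[of jN jD] jN jD by simp
  have pts: "pts ?N = range jN" "pts ?D = jD ` GN" by (simp_all add: N_obj_def Delta_obj_def)
  have sp: "space (N_space jN) = range jN" "space (GN_space jD) = jD ` GN"
    by (simp_all add: N_space_def GN_space_def space_embed_measure)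
  have F: "FOb ?F ?N = N_space jN" "FOb ?F ?D = GN_space jD" "FHom ?F a b f = f" for a b f
    using ne by (simp_all add: Sigma_functor_def)
  have UV: "\<U> \<subseteq> \<V>" using U by (simp add: universes_def)
  show Ob: "{?N, ?D} \<subseteq> Ob (SCvx \<U>)"
    using jN jD scvx_embed[OF scvx_N, of jN] scvx_embed[OF scvx_Delta, of jD]
    by (simp add: pts) (simp add: N_obj_def Delta_obj_def)
  have space: "space (FOb ?F t) = pts t" if "t \<in> {?N, ?D}" for t
    using that by (auto simp: F sp pts)
  then show "t \<in> {?N, ?D} \<Longrightarrow> space (FOb ?F t) = pts t" .
  have meas: "f \<in> measurable (FOb ?F a) (FOb ?F b)"
    if a: "a \<in> {?N, ?D}" and b: "b \<in> {?N, ?D}" and f: "f \<in> countably_affine a b" for a b f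
  proof -
    have jN': "inj_on jN (pts N_scvx)" and jD': "inj_on jD (pts Delta_scvx)" using jN jD by simp_all
    note NN = measurable_between_embeddings[OF jN' jN' scvx_N scvx_N, of N_meas N_meas]
    note ND = measurable_between_embeddings[OF jN' jD' scvx_N scvx_Delta, of N_meas GN_meas]
    note DN = measurable_between_embeddings[OF jD' jN' scvx_Delta scvx_N, of GN_meas N_meas]
    note DD = measurable_between_embeddings[OF jD' jD' scvx_Delta scvx_Delta, of GN_meas GN_meas]
    consider "a = ?N" "b = ?N" | "a = ?N" "b = ?D" | "a = ?D" "b = ?N" | "a = ?D" "b = ?D"
      using a b by blast
    then show ?thesis
    proof cases
      case 1 show ?thesis
        using NN[of f] f affine_measurable_from_N[of _ N_scvx N_meas] unfolding 1 F
        by (simp add: N_obj_def N_space_def)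
    next
      case 2 show ?thesis
        using ND[of f] f affine_measurable_from_N[of _ Delta_scvx GN_meas] unfolding 2 F
        by (simp add: N_obj_def N_space_def Delta_obj_def GN_space_def)
    next
      case 3 show ?thesis
        using DN[of f] f affine_measurable_Delta_N unfolding 3 F
        by (simp add: N_obj_def N_space_def Delta_obj_def GN_space_def)
    next
      case 4 show ?thesis
        using DD[of f] f affine_measurable_Delta_Delta unfolding 4 F
        by (simp add: Delta_obj_def GN_space_def)
    qed
  qed
  have FOb_in: "FOb ?F t \<in> Ob (Meas \<V>)" if "t \<in> {?N, ?D}" for t
  proof -
    have "emeasure (FOb ?F t) = (\<lambda>_. 0)"
      using that by (auto simp: F N_space_def GN_space_def embed_measure_zero)
    then show ?thesis using that space[OF that] UV jN jD by (auto simp: pts)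
  qed
  show "is_functor (Omega \<U> jN jD) (Meas \<V>) ?F"
    unfolding is_functor_def Omega_def full_subcategory_simps
  proof (intro conjI ballI)
    show "is_category (full_subcategory (SCvx \<U>) {?N, ?D})"
      by (rule category_full_subcategory[OF category_SCvx])
    show "is_category (Meas \<V>)" by (rule category_Meas)
    show "FOb ?F a \<in> Ob (Meas \<V>)" if "a \<in> Ob (SCvx \<U>) \<inter> {?N, ?D}" for a
      using FOb_in that by blast
    fix a assume a: "a \<in> Ob (SCvx \<U>) \<inter> {?N, ?D}"
    then have sa: "space (FOb ?F a) = pts a" using space by blast
    show "FHom ?F a a (Id (SCvx \<U>) a) = Id (Meas \<V>) (FOb ?F a)" by (simp add: F sa)
    fix b f assume b: "b \<in> Ob (SCvx \<U>) \<inter> {?N, ?D}" and f: "f \<in> Hom (SCvx \<U>) a b"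
    then have "f \<in> extensional (pts a)" by (simp add: countably_affine_def PiE_iff)
    then show "FHom ?F a b f \<in> Hom (Meas \<V>) (FOb ?F a) (FOb ?F b)"
      using meas[of a b f] a b f by (simp add: F sa)
    show "FHom ?F a c (Comp (SCvx \<U>) a b c g f) =
        Comp (Meas \<V>) (FOb ?F a) (FOb ?F b) (FOb ?F c) (FHom ?F b c g) (FHom ?F a b f)" for c g
      by (simp add: F sa)
  qed
qed

text \<open>
  For nonempty \<open>c\<close> this is the general bound, as both objects have at most continuum many points. The
  general bound fails for empty \<open>c\<close>, where instead no compatible family exists.
\<close>

lemma compatible_families_small:
  assumes U: "universes \<U> \<V>"
    and jN: "inj jN" "range jN \<in> \<U>" and jD: "inj_on jD GN" "jD ` GN \<in> \<U>"
    and c: "c \<in> Ob (SCvx \<U>)"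
  shows "compatible_families (SCvx \<U>) {N_obj jN, Delta_obj jD} (Sigma_functor jN jD) c
    \<lesssim> Pow (Pow (pts c \<times> (UNIV :: nat set)))" (is "compatible_families _ ?S ?F c \<lesssim> _")
proof (cases "pts c = {}")
  case True
  have "compatible_families (SCvx \<U>) ?S ?F c = {}"
    by (rule no_compatible_families_on_empty[OF jN(1) _ True])
      (simp_all add: Sigma_functor_def N_space_def space_embed_measure)
  then show ?thesis by simp
next
  case False
  note space = Sigma_functor_into_Meas(3)[OF U jN jD]
  have small: "pts t \<lesssim> (UNIV :: nat set set)" if "t \<in> ?S" for t
  proof -
    have "range jN \<lesssim> (UNIV :: nat set)" by (rule image_lepoll)
    also have "(UNIV :: nat set) \<lesssim> (UNIV :: nat set set)"
      using lepoll_Pow_self[of "UNIV :: nat set"] by simp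
    finally have N: "range jN \<lesssim> (UNIV :: nat set set)" .
    have "jD ` GN \<lesssim> GN" by (rule image_lepoll)
    also have "GN \<lesssim> (UNIV :: (nat \<Rightarrow> real) set)" by (rule subset_imp_lepoll) simp
    also have "\<dots> \<lesssim> (UNIV :: nat set set)" by (rule sequences_lepoll_sets)
    finally have "jD ` GN \<lesssim> (UNIV :: nat set set)" .
    then show ?thesis using N that by (auto simp: N_obj_def Delta_obj_def)
  qed
  have "compatible_families (SCvx \<U>) ?S ?F c
      \<subseteq> (\<Pi>\<^sub>E (t, f)\<in>(SIGMA t:?S. countably_affine c t). pts t)"
  proof (intro subsetI PiE_I)
    fix \<phi> i assume \<phi>: "\<phi> \<in> compatible_families (SCvx \<U>) ?S ?F c"
    let ?I = "SIGMA t:?S. countably_affine c t"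
    show "\<phi> i = undefined" if "i \<notin> ?I"
      using \<phi> that unfolding compatible_families_def SCvx_simps by (blast intro: extensional_arb)
    show "\<phi> i \<in> (case i of (t, f) \<Rightarrow> pts t)" if "i \<in> ?I"
    proof -
      obtain t f where i: "i = (t, f)" and t: "t \<in> ?S" and f: "f \<in> countably_affine c t"
        using \<open>i \<in> ?I\<close> by blast
      then have "\<phi> (t, f) \<in> space (FOb ?F t)"
        using \<phi> unfolding compatible_families_def SCvx_simps by blast
      then show ?thesis using space[OF t] i by simp
    qed
  qed
  note sub = subset_imp_lepoll[OF this]
  have "(\<Pi>\<^sub>E (t, f)\<in>(SIGMA t:?S. countably_affine c t). pts t) \<lesssim> Pow (Pow (pts c \<times> (UNIV :: nat set)))"
    by (rule families_lepoll[where Z = pts])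
      (use False small in \<open>auto simp: countably_affine_def\<close>)
  then show ?thesis by (rule lepoll_trans[OF sub])
qed

theorem lemma1p1:
  fixes \<U> \<V> :: "'v set set"
    and jN :: "nat \<Rightarrow> 'v" and jD :: "(nat \<Rightarrow> real) \<Rightarrow> 'v"
  assumes "universes \<U> \<V>"
    and "inj jN" and "range jN \<in> \<U>"
    and "inj_on jD GN" and "jD ` GN \<in> \<U>"
  shows "\<exists>R \<epsilon>.
    is_right_Kan_extension (Omega \<U> jN jD) (SCvx \<U>) (Meas \<V>)
      inclusion_functor (Sigma_functor jN jD) R \<epsilon> \<and>
    \<epsilon> (N_obj jN) = Id (Meas \<V>) (N_space jN) \<and>
    \<epsilon> (Delta_obj jD) = Id (Meas \<V>) (GN_space jD) \<and>
    functor_eq (Omega \<U> jN jD) (functor_comp R inclusion_functor) (Sigma_functor jN jD)"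
proof -
  let ?C = "SCvx \<U>" and ?D = "Meas \<V>" and ?S = "{N_obj jN, Delta_obj jD}" and ?T = "Sigma_functor jN jD"
  note S = Sigma_functor_into_Meas(2)[OF assms]
  have T: "is_functor (full_subcategory ?C ?S) ?D ?T"
    using Sigma_functor_into_Meas(1)[OF assms] by (simp add: Omega_def)
  have "\<exists>L \<pi>. is_limit_cone ?C ?S ?D ?T c L \<pi> \<and> (c \<in> ?S \<longrightarrow> L = FOb ?T c \<and> \<pi> = FHom ?T c)"
    if c: "c \<in> Ob ?C" for c
  proof (cases "c \<in> ?S")
    case True
    then show ?thesis using limit_cone_on_subcategory[OF category_SCvx category_Meas S T] by blast
  next
    case False
    obtain B where B: "B \<in> \<V>" "Pow (Pow (pts c \<times> (UNIV :: nat set))) \<lesssim> B"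
      using assms(1) c by (auto simp: universes_def)
    have sub: "A \<in> \<V>" if "A \<subseteq> B" for A
      using assms(1) B that by (auto simp: universes_def)
    show ?thesis
      using limit_cone_in_Meas[OF category_SCvx S c sub
          lepoll_trans[OF compatible_families_small[OF assms c] B(2)]] False by blast
  qed
  then obtain L \<pi> where limit: "\<And>c. c \<in> Ob ?C \<Longrightarrow> is_limit_cone ?C ?S ?D ?T c (L c) (\<pi> c)"
    and on: "\<And>c. c \<in> Ob ?C \<Longrightarrow> c \<in> ?S \<Longrightarrow> L c = FOb ?T c \<and> \<pi> c = FHom ?T c"
    by metis
  interpret pointwise_limits ?C ?S ?D ?T L \<pi>
    by unfold_locales (use category_SCvx S T limit on in auto)
  have "N_obj jN \<noteq> Delta_obj jD" by (rule N_obj_neq_Delta_obj[OF assms(2,4)])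
  then have "FOb ?T (N_obj jN) = N_space jN" "FOb ?T (Delta_obj jD) = GN_space jD"
    by (simp_all add: Sigma_functor_def)
  then show ?thesis
    using Kan_extension R_extends unfolding Omega_def by (intro exI[of _ R] exI[of _ \<epsilon>]) simp
qed

end
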